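(* For every $\alpha\in(0,2]$, with $B_\alpha$ a standard fractional Brownian motion as in the context, $$\lim_{\eta\downarrow0}\eta^{-2/\alpha}\,\mathbb{P}\bigl\{B_\alpha(1/k)\le\eta\ \text{ for all } k\in\mathbb{Z}\setminus\{0\}\bigr\}=2^{1/\alpha}\,\mathcal{H}_{B_\alpha}.$$
   Context: For $\alpha\in(0,2]$, $B_\alpha(t),t\in\mathbb{R}$, denotes the standard fractional Brownian motion with Hurst index $\alpha/2$: the centered Gaussian process with continuous sample paths, stationary increments, $B_\alpha(0)=0$ and variance function $\mathrm{Var}(B_\alpha(t))=|t|^\alpha$. The classical Pickands constant is $$\mathcal{H}_{B_\alpha}=\lim_{T\to\infty}\frac1T\,\mathbb{E}\Bigl\{\sup_{t\in[0,T]}e^{\sqrt2B_\alpha(t)-|t|^\alpha}\Bigr\}\in(0,\infty).$$ *)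

theory Defs
  imports "HOL-Probability.Probability"
begin

text \<open>Point masses count as Gaussian: a linear combination of the coordinates of a Gaussian
  process may be degenerate (e.g. the value at time \<open>0\<close> of a fractional Brownian motion).\<close>

definition gaussian_rv :: "'a measure \<Rightarrow> ('a \<Rightarrow> real) \<Rightarrow> bool" where
  "gaussian_rv M X \<longleftrightarrow> X \<in> borel_measurable M \<and>
     ((\<exists>m. AE \<omega> in M. X \<omega> = m) \<or>
      (\<exists>m s. s > 0 \<and> distributed M lborel X (\<lambda>x. ennreal (normal_density m s x))))"

definition gaussian_process :: "'a measure \<Rightarrow> ('t \<Rightarrow> 'a \<Rightarrow> real) \<Rightarrow> bool" where
  "gaussian_process M X \<longleftrightarrow>
     (\<forall>S c. finite S \<longrightarrow> gaussian_rv M (\<lambda>\<omega>. \<Sum>t\<in>S. c t * X t \<omega>))"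

text \<open>Equality of laws on the product \<open>\<sigma>\<close>-algebra, i.e. of all finite-dimensional
  distributions of the increment processes.\<close>

definition stationary_increments :: "'a measure \<Rightarrow> (real \<Rightarrow> 'a \<Rightarrow> real) \<Rightarrow> bool" where
  "stationary_increments M X \<longleftrightarrow>
     (\<forall>h. distr M (\<Pi>\<^sub>M t\<in>UNIV. borel) (\<lambda>\<omega> t. X (t + h) \<omega> - X h \<omega>) =
          distr M (\<Pi>\<^sub>M t\<in>UNIV. borel) (\<lambda>\<omega> t. X t \<omega> - X 0 \<omega>))"

text \<open>The parameter \<open>\<alpha>\<close> is twice the Hurst index.\<close>

locale standard_fbm = prob_space M
  for M :: "'a measure" and \<alpha> :: real and B :: "real \<Rightarrow> 'a \<Rightarrow> real" +
  assumes gaussian: "gaussian_process M B"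
    and centered: "expectation (B t) = 0"
    and continuous_paths: "\<omega> \<in> space M \<Longrightarrow> continuous_on UNIV (\<lambda>t. B t \<omega>)"
    and stationary: "stationary_increments M B"
    and starts_at_0: "\<omega> \<in> space M \<Longrightarrow> B 0 \<omega> = 0"
    and variance: "variance (B t) = \<bar>t\<bar> powr \<alpha>"

text \<open>\<open>Lim\<close> and the Bochner integral are meaningful because the supremum has finite expectation and
  the normalized expectations converge, both classical for \<open>0 < \<alpha> \<le> 2\<close>. The constant depends only on
  the law of \<open>B\<close>, hence only on \<open>\<alpha>\<close>.\<close>

definition pickands_constant :: "'a measure \<Rightarrow> real \<Rightarrow> (real \<Rightarrow> 'a \<Rightarrow> real) \<Rightarrow> real" where
  "pickands_constant M \<alpha> B =
     Lim at_top (\<lambda>T. 1 / T *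
       (LINT \<omega>|M. (SUP t\<in>{0..T}. exp (sqrt 2 * B t \<omega> - \<bar>t\<bar> powr \<alpha>))))"

end

theory Submission
  imports Defs
begin

text \<open>Write \<open>Z t = sqrt 2 * B t - \<bar>t\<bar> powr \<alpha>\<close>. Tilting the measure by \<open>exp (Z t)\<close> turns the law of
  \<open>Z s - Z t\<close> into that of \<open>Z (s - t)\<close>. Splitting the maximum of \<open>exp \<circ> Z\<close> over \<open>N\<close> points of the grid
  of mesh \<open>\<delta>\<close> according to its first maximizer, its expectation becomes a sum of \<open>N\<close> probabilities that
  \<open>Z\<close> stays nonpositive on a window of the grid around the origin; divided by \<open>N\<close>, it converges to the
  probability \<open>p \<delta>\<close> that \<open>Z \<le> 0\<close> on the whole grid. So \<open>p \<delta> / \<delta>\<close> is the Pickands constant of the grid.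
  Since errors of discretization are subadditive over blocks of length about \<open>1\<close>, it converges to the
  continuous constant as \<open>\<delta> \<rightarrow> 0\<close>. Finally \<open>\<bar>t\<bar> powr \<alpha> * B (1 / t)\<close> is again a fractional Brownian
  motion, and by self-similarity the event of the theorem has probability \<open>p \<delta>\<close> for
  \<open>\<delta> = 2 powr (1 / \<alpha>) * \<eta> powr (2 / \<alpha>)\<close>.\<close>

section \<open>Laws determined by trigonometric moments\<close>

text \<open>The tilt is a Cameron-Martin shift. The variance of \<open>sqrt 2 * B t\<close> is
  \<open>2 * \<bar>t\<bar> powr \<alpha>\<close>, so \<open>exp (Z t)\<close> has mean one, and its
  covariance with \<open>sqrt 2 * (B s - B t)\<close> is exactly what turns the drift of
  \<open>Z s - Z t\<close> into that of \<open>Z (s - t)\<close>. Gaussianity is given only for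
  single linear combinations, so the shift is proved for trigonometric moments and then lifted to
  laws on the product space.

  The delicate point is an exchange of limits: the grid constant is a limit over long horizons at
  fixed mesh, while path continuity compares grid and interval only on a bounded horizon.
  Subadditivity of the error carries the comparison on one block over to all horizons. Dominated
  convergence on that block needs an integrable supremum, which dyadic chaining supplies.\<close>

text \<open>The characteristic function at 0 is the total mass, so both measures have the same mass,
  and dividing by it reduces the claim to Levy uniqueness. Mass 0 cannot be normalized and is
  treated apart.\<close>

lemma finite_measure_eqI_char:
  fixes M N :: "real measure"
  assumes "finite_measure M" "finite_measure N"
    and sets [simp, measurable_cong]: "sets M = sets borel" "sets N = sets borel"
    and eq: "char M = char N"
  shows "M = N"
proof -
  interpret M: finite_measure M by fact
  interpret N: finite_measure N by fact
  have sp [simp]: "space M = UNIV" "space N = UNIV"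
    using sets_eq_imp_space_eq[OF sets(1)] sets_eq_imp_space_eq[OF sets(2)] by auto
  have "char M 0 = measure M UNIV" "char N 0 = measure N UNIV"
    unfolding char_def by (simp_all add: scaleR_conv_of_real)
  then have mass: "measure M UNIV = measure N UNIV"
    using eq by (metis of_real_eq_iff)
  define m where "m = measure M UNIV"
  show ?thesis
  proof (cases "m = 0")
    case True
    have 0: "emeasure M UNIV = 0" "emeasure N UNIV = 0"
      using True mass by (simp_all add: M.emeasure_eq_measure N.emeasure_eq_measure m_def)
    show ?thesis
    proof (rule measure_eqI)
      fix A
      have "emeasure M A \<le> emeasure M UNIV" "emeasure N A \<le> emeasure N UNIV"
        by (auto intro!: emeasure_mono)
      then show "emeasure M A = emeasure N A" using 0 by simp
    qed simp
  next
    case False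
    then have m: "m > 0" by (simp add: m_def less_le)
    let ?S = "\<lambda>K. density K (\<lambda>_. ennreal (1 / m))"
    have rd: "real_distribution (?S K)"
      if "finite_measure K" "sets K = sets borel" "space K = UNIV" "measure K UNIV = m" for K :: "real measure"
    proof -
      interpret finite_measure K by fact
      have "emeasure (?S K) (space (?S K)) = 1"
        using that m by (simp add: emeasure_density emeasure_eq_measure flip: ennreal_mult)
      then show ?thesis
        by (intro real_distribution.intro real_distribution_axioms.intro prob_spaceI)
          (simp_all add: that)
    qed
    have ch: "char (?S K) = (\<lambda>t. char K t / m)" if [measurable_cong]: "sets K = sets borel" for K :: "real measure"
    proof
      fix t
      have "char (?S K) t = (CLINT x|K. (1 / m) *\<^sub>R iexp (t * x))"
        unfolding char_def using m by (subst integral_density) auto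
      also have "\<dots> = char K t / m"
        unfolding char_def integral_scaleR_right by (simp add: scaleR_conv_of_real)
      finally show "char (?S K) t = char K t / m" .
    qed
    have *: "?S M = ?S N"
      using rd[of M] rd[of N] ch[of M] ch[of N] mass eq assms(1,2)
      by (intro Levy_uniqueness) (simp_all add: m_def)
    show ?thesis
    proof (rule measure_eqI)
      fix A assume "A \<in> sets M"
      then have "A \<in> sets M" "A \<in> sets N" by simp_all
      then have "ennreal (1 / m) * emeasure M A = ennreal (1 / m) * emeasure N A"
        using arg_cong[OF *, of "\<lambda>K. emeasure K A"] by (simp add: emeasure_density nn_integral_cmult)
      then show "emeasure M A = emeasure N A"
        using m by (simp add: M.emeasure_eq_measure N.emeasure_eq_measure flip: ennreal_mult)
    qed simp
  qed
qed

text \<open>The free phase \<open>a\<close> lets one real identity carry both parts of the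
  characteristic function: \<open>a = 0\<close> gives the cosine and \<open>a = - pi / 2\<close> the
  sine.\<close>

lemma distr_density_eqI:
  fixes X :: "'a \<Rightarrow> real" and Y :: "'b \<Rightarrow> real"
  assumes [measurable]: "X \<in> borel_measurable M" "Y \<in> borel_measurable N"
    and w: "integrable M w" "\<And>x. 0 \<le> w x" and v: "integrable N v" "\<And>x. 0 \<le> v x"
    and eq: "\<And>\<theta> a. (LINT x|M. w x * cos (\<theta> * X x + a)) = (LINT x|N. v x * cos (\<theta> * Y x + a))"
  shows "distr (density M w) borel X = distr (density N v) borel Y"
proof (rule finite_measure_eqI_char)
  have fin: "finite_measure (distr (density K u) borel Z)"
    if "integrable K u" "\<And>x. 0 \<le> u x" "Z \<in> borel_measurable K"
    for K :: "'c measure" and u and Z :: "'c \<Rightarrow> real"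
  proof -
    have [measurable]: "u \<in> borel_measurable K" "Z \<in> borel_measurable K" using that by auto
    have "(\<integral>\<^sup>+ x. u x \<partial>K) < \<infinity>"
      using that by (subst nn_integral_eq_integral) auto
    then have "finite_measure (density K u)"
      by (intro finite_measureI) (simp add: emeasure_density cong: nn_integral_cong)
    then show ?thesis by (intro finite_measure.finite_measure_distr) simp_all
  qed
  show "finite_measure (distr (density M w) borel X)" "finite_measure (distr (density N v) borel Y)"
    using fin[OF w assms(1)] fin[OF v assms(2)] by auto
  have ch: "char (distr (density K u) borel Z) t =
      Complex (LINT x|K. u x * cos (t * Z x + 0)) (LINT x|K. u x * cos (t * Z x + - pi / 2))"
    if "integrable K u" "\<And>x. 0 \<le> u x" "Z \<in> borel_measurable K"
    for K :: "'c measure" and u and Z :: "'c \<Rightarrow> real" and t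
  proof -
    have [measurable]: "u \<in> borel_measurable K" "Z \<in> borel_measurable K" using that by auto
    have "char (distr (density K u) borel Z) t = (CLINT x|K. u x *\<^sub>R iexp (t * Z x))"
      unfolding char_def using that by (subst integral_distr) (auto simp: integral_density)
    moreover have "integrable K (\<lambda>x. u x *\<^sub>R iexp (t * Z x))"
      by (rule Bochner_Integration.integrable_bound[OF that(1)]) auto
    moreover have "cos (y + - pi / 2) = sin y" for y :: real
      by (simp add: cos_diff)
    ultimately show ?thesis
      by (simp add: complex_eq_iff Re_exp Im_exp flip: integral_Re integral_Im)
  qed
  show "char (distr (density M w) borel X) = char (distr (density N v) borel Y)"
    using ch[OF w assms(1)] ch[OF v assms(2)] by (intro ext) (simp only: eq)
qed simp_all

text \<open>Both sides integrate \<open>g\<close> against one and the same law, so they agree even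
  for unbounded \<open>g\<close>; it is applied to indicators and to \<open>exp\<close>.\<close>

lemma integral_weight_eqI:
  fixes X :: "'a \<Rightarrow> real" and Y :: "'b \<Rightarrow> real" and g :: "real \<Rightarrow> real"
  assumes [measurable]: "X \<in> borel_measurable M" "Y \<in> borel_measurable N"
    and w: "integrable M w" "\<And>x. 0 \<le> w x" and v: "integrable N v" "\<And>x. 0 \<le> v x"
    and eq: "\<And>\<theta> a. (LINT x|M. w x * cos (\<theta> * X x + a)) = (LINT x|N. v x * cos (\<theta> * Y x + a))"
    and [measurable]: "g \<in> borel_measurable borel"
  shows "(LINT x|M. w x * g (X x)) = (LINT x|N. v x * g (Y x))"
proof -
  have [measurable]: "w \<in> borel_measurable M" "v \<in> borel_measurable N" using w v by auto
  have "(LINT x|distr (density M w) borel X. g x) = (LINT x|distr (density N v) borel Y. g x)"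
    using distr_density_eqI[OF assms(1-7)] by simp
  then show ?thesis using w v by (simp add: integral_distr integral_density)
qed

text \<open>Coordinates are converted one at a time from trigonometric factors to indicators; the
  positive weights \<open>1 + cos\<close> keep all measures nonnegative, so that the one-dimensional uniqueness
  theorem for characteristic functions applies at each step.\<close>

lemma distr_PiM_eqI_cos:
  fixes X :: "'t \<Rightarrow> 'a \<Rightarrow> real" and Y :: "'t \<Rightarrow> 'b \<Rightarrow> real"
  assumes M: "prob_space M" and N: "prob_space N"
    and [measurable]: "\<And>t. X t \<in> borel_measurable M" "\<And>t. Y t \<in> borel_measurable N"
    and eq: "\<And>S c a. finite S \<Longrightarrow>
      (LINT \<omega>|M. cos ((\<Sum>t\<in>S. c t * X t \<omega>) + a)) = (LINT \<omega>|N. cos ((\<Sum>t\<in>S. c t * Y t \<omega>) + a))"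
  shows "distr M (\<Pi>\<^sub>M t\<in>UNIV. borel) (\<lambda>\<omega> t. X t \<omega>) = distr N (\<Pi>\<^sub>M t\<in>UNIV. borel) (\<lambda>\<omega> t. Y t \<omega>)"
proof -
  interpret M: prob_space M by fact
  interpret N: prob_space N by fact
  have main: "(LINT \<omega>|M. (\<Prod>j\<in>J. indicator (A j) (X j \<omega>)) * cos ((\<Sum>t\<in>S. c t * X t \<omega>) + a))
      = (LINT \<omega>|N. (\<Prod>j\<in>J. indicator (A j) (Y j \<omega>)) * cos ((\<Sum>t\<in>S. c t * Y t \<omega>) + a))"
    if S: "finite S" and "finite J" "J \<subseteq> S" and "\<And>j. A j \<in> sets borel"
    for S J :: "'t set" and A :: "'t \<Rightarrow> real set" and c :: "'t \<Rightarrow> real" and a :: real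
    using that(2-)
  proof (induction J arbitrary: c a)
    case empty
    then show ?case using eq[OF S] by simp
  next
    case (insert j J)
    have [measurable]: "A j \<in> sets borel" for j by fact
    define u where "u z = (\<Prod>j\<in>J. indicator (A j) (z j) :: real)" for z
    define L where "L c z = (\<Sum>t\<in>S. c t * z t)" for c and z :: "'t \<Rightarrow> real"
    have um [measurable]: "(\<lambda>\<omega>. u (\<lambda>t. X t \<omega>)) \<in> borel_measurable M" "(\<lambda>\<omega>. u (\<lambda>t. Y t \<omega>)) \<in> borel_measurable N"
      unfolding u_def by measurable
    have Lm [measurable]: "(\<lambda>\<omega>. L c (\<lambda>t. X t \<omega>)) \<in> borel_measurable M" "(\<lambda>\<omega>. L c (\<lambda>t. Y t \<omega>)) \<in> borel_measurable N" for c
      unfolding L_def by measurable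
    have u01: "0 \<le> u z" "u z \<le> 1" for z
      unfolding u_def by (auto intro!: prod_nonneg prod_le_1)
    have int: "integrable M (\<lambda>\<omega>. u (\<lambda>t. X t \<omega>) * cos (f \<omega>))" "integrable N (\<lambda>\<omega>. u (\<lambda>t. Y t \<omega>) * cos (g \<omega>))"
      if [measurable]: "f \<in> borel_measurable M" "g \<in> borel_measurable N" for f g
      by (auto intro!: M.integrable_const_bound[where B=1] N.integrable_const_bound[where B=1]
          simp: abs_mult u01 mult_le_one)
    have IH: "(LINT \<omega>|M. u (\<lambda>t. X t \<omega>) * cos (L c (\<lambda>t. X t \<omega>) + a)) = (LINT \<omega>|N. u (\<lambda>t. Y t \<omega>) * cos (L c (\<lambda>t. Y t \<omega>) + a))" for c a
      using insert.IH[of c a] insert.prems insert.hyps unfolding u_def L_def by auto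
    \<comment> \<open>Since \<open>j\<close> lies in \<open>S\<close>, an extra term
      \<open>\<theta> * z j\<close> is only a change of the frequency \<open>c j\<close>; this is
      why the induction keeps all of \<open>S\<close> inside the cosine.\<close>
    have Lupd: "L (c(j := c j + \<theta>)) z = L c z + \<theta> * z j" for c \<theta> z
    proof -
      have "L (c(j := c j + \<theta>)) z = (\<Sum>t\<in>S. c t * z t + (if t = j then \<theta> * z t else 0))"
        unfolding L_def by (intro sum.cong) (auto simp: algebra_simps)
      also have "\<dots> = L c z + \<theta> * z j"
        using insert.prems S by (simp add: sum.distrib L_def)
      finally show ?thesis .
    qed
    have IH2: "(LINT \<omega>|M. u (\<lambda>t. X t \<omega>) * cos (L c (\<lambda>t. X t \<omega>) + \<theta> * X j \<omega> + a))
        = (LINT \<omega>|N. u (\<lambda>t. Y t \<omega>) * cos (L c (\<lambda>t. Y t \<omega>) + \<theta> * Y j \<omega> + a))" for c \<theta> a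
      using IH[of "c(j := c j + \<theta>)" a] by (simp only: Lupd)
    have L0: "L (\<lambda>_. 0) z = 0" for z
      unfolding L_def by simp
    have IH0: "(LINT \<omega>|M. u (\<lambda>t. X t \<omega>) * cos (\<theta> * X j \<omega> + a)) = (LINT \<omega>|N. u (\<lambda>t. Y t \<omega>) * cos (\<theta> * Y j \<omega> + a))" for \<theta> a
      using IH2[of "\<lambda>_. 0" \<theta> a] by (simp add: L0)
    have intu: "integrable M (\<lambda>\<omega>. u (\<lambda>t. X t \<omega>))" "integrable N (\<lambda>\<omega>. u (\<lambda>t. Y t \<omega>))"
      by (rule M.integrable_const_bound[where B=1] N.integrable_const_bound[where B=1]; simp add: u01)+
    have A: "(LINT \<omega>|M. u (\<lambda>t. X t \<omega>) * indicator (A j) (X j \<omega>)) = (LINT \<omega>|N. u (\<lambda>t. Y t \<omega>) * indicator (A j) (Y j \<omega>))"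
    proof (rule integral_weight_eqI[where X="X j" and Y="Y j" and g="indicator (A j)"
          and w="\<lambda>\<omega>. u (\<lambda>t. X t \<omega>)" and v="\<lambda>\<omega>. u (\<lambda>t. Y t \<omega>)"])
      show "(LINT \<omega>|M. u (\<lambda>t. X t \<omega>) * cos (\<theta> * X j \<omega> + a)) = (LINT \<omega>|N. u (\<lambda>t. Y t \<omega>) * cos (\<theta> * Y j \<omega> + a))" for \<theta> a
        by (rule IH0)
    qed (simp_all add: u01 intu)
    \<comment> \<open>Product-to-sum: testing the weight \<open>1 + cos\<close> against a cosine of
      coordinate \<open>j\<close> produces only moments covered by the induction hypothesis.\<close>
    have exp: "y * (1 + cos (l + a)) * cos (\<theta> * z + b)
      = y * cos (\<theta> * z + b) + (1/2) * (y * cos (l + (-\<theta>) * z + (a - b)))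
        + (1/2) * (y * cos (l + \<theta> * z + (a + b)))"
      for y l a \<theta> z b :: real
    proof -
      have "cos (l + a) * cos (\<theta> * z + b) =
          (cos (l + (-\<theta>) * z + (a - b)) + cos (l + \<theta> * z + (a + b))) / 2"
        unfolding cos_times_cos by (simp add: algebra_simps)
      moreover have "y * (1 + C) * D = y * D + (1/2) * (y * P) + (1/2) * (y * Q)"
        if "C * D = (P + Q) / 2" for C D P Q :: real
      proof -
        have "y * (1 + C) * D = y * D + y * (C * D)" by (simp add: algebra_simps)
        then show ?thesis unfolding that by (simp add: field_simps)
      qed
      ultimately show ?thesis by blast
    qed
    have intw: "integrable M (\<lambda>\<omega>. u (\<lambda>t. X t \<omega>) * (1 + cos (L c (\<lambda>t. X t \<omega>) + a)))"
        "integrable N (\<lambda>\<omega>. u (\<lambda>t. Y t \<omega>) * (1 + cos (L c (\<lambda>t. Y t \<omega>) + a)))"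
      unfolding distrib_left mult_1_right
      by (intro Bochner_Integration.integrable_add intu int; measurable)+
    have B: "(LINT \<omega>|M. (u (\<lambda>t. X t \<omega>) * (1 + cos (L c (\<lambda>t. X t \<omega>) + a))) * indicator (A j) (X j \<omega>))
        = (LINT \<omega>|N. (u (\<lambda>t. Y t \<omega>) * (1 + cos (L c (\<lambda>t. Y t \<omega>) + a))) * indicator (A j) (Y j \<omega>))"
    proof (rule integral_weight_eqI[where X="X j" and Y="Y j" and g="indicator (A j)"
          and w="\<lambda>\<omega>. u (\<lambda>t. X t \<omega>) * (1 + cos (L c (\<lambda>t. X t \<omega>) + a))"
          and v="\<lambda>\<omega>. u (\<lambda>t. Y t \<omega>) * (1 + cos (L c (\<lambda>t. Y t \<omega>) + a))"])
      fix \<theta> b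
      show "(LINT x|M. u (\<lambda>t. X t x) * (1 + cos (L c (\<lambda>t. X t x) + a)) * cos (\<theta> * X j x + b))
          = (LINT x|N. u (\<lambda>t. Y t x) * (1 + cos (L c (\<lambda>t. Y t x) + a)) * cos (\<theta> * Y j x + b))"
        unfolding exp
        by (subst Bochner_Integration.integral_add,
            (intro Bochner_Integration.integrable_add integrable_mult_right int; measurable),
            (intro integrable_mult_right int; measurable))+
          (simp only: integral_mult_right_zero IH0 IH2)
    next
      show "0 \<le> u (\<lambda>t. X t x) * (1 + cos (L c (\<lambda>t. X t x) + a))" for x
        using cos_ge_minus_one[of "L c (\<lambda>t. X t x) + a"] u01[of "\<lambda>t. X t x"] by (intro mult_nonneg_nonneg) linarith+
      show "0 \<le> u (\<lambda>t. Y t x) * (1 + cos (L c (\<lambda>t. Y t x) + a))" for x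
        using cos_ge_minus_one[of "L c (\<lambda>t. Y t x) + a"] u01[of "\<lambda>t. Y t x"] by (intro mult_nonneg_nonneg) linarith+
    qed (simp_all add: intw)
    have split: "(LINT \<omega>|K. u (\<lambda>t. Z t \<omega>) * (1 + cos (L c (\<lambda>t. Z t \<omega>) + a)) * indicator (A j) (Z j \<omega>))
        = (LINT \<omega>|K. u (\<lambda>t. Z t \<omega>) * indicator (A j) (Z j \<omega>))
          + (LINT \<omega>|K. (\<Prod>j\<in>insert j J. indicator (A j) (Z j \<omega>)) * cos ((\<Sum>t\<in>S. c t * Z t \<omega>) + a))"
      if "integrable K (\<lambda>\<omega>. u (\<lambda>t. Z t \<omega>) * indicator (A j) (Z j \<omega>))"
        "integrable K (\<lambda>\<omega>. (\<Prod>j\<in>insert j J. indicator (A j) (Z j \<omega>)) * cos ((\<Sum>t\<in>S. c t * Z t \<omega>) + a))"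
      for Z :: "'t \<Rightarrow> 'c \<Rightarrow> real" and K
      using that insert.hyps
      by (subst Bochner_Integration.integral_add[symmetric])
        (auto simp: u_def L_def algebra_simps intro!: Bochner_Integration.integral_cong)
    have b1: "\<bar>u (\<lambda>t. Z t \<omega>) * indicator (A j) (Z j \<omega>)\<bar> \<le> 1" for Z :: "'t \<Rightarrow> 'c \<Rightarrow> real" and \<omega>
      by (auto simp: u01 indicator_def)
    have b2: "\<bar>(\<Prod>j\<in>insert j J. indicator (A j) (Z j \<omega>)) * cos ((\<Sum>t\<in>S. c t * Z t \<omega>) + a)\<bar> \<le> 1"
      for Z :: "'t \<Rightarrow> 'c \<Rightarrow> real" and \<omega>
      unfolding abs_mult by (intro mult_le_one) (auto simp: abs_prod intro!: prod_le_1)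
    have i1: "integrable M (\<lambda>\<omega>. u (\<lambda>t. X t \<omega>) * indicator (A j) (X j \<omega>))"
        "integrable M (\<lambda>\<omega>. (\<Prod>j\<in>insert j J. indicator (A j) (X j \<omega>)) * cos ((\<Sum>t\<in>S. c t * X t \<omega>) + a))"
      using b1[of X] b2[of X] by (auto intro!: M.integrable_const_bound[where B=1])
    have i2: "integrable N (\<lambda>\<omega>. u (\<lambda>t. Y t \<omega>) * indicator (A j) (Y j \<omega>))"
        "integrable N (\<lambda>\<omega>. (\<Prod>j\<in>insert j J. indicator (A j) (Y j \<omega>)) * cos ((\<Sum>t\<in>S. c t * Y t \<omega>) + a))"
      using b1[of Y] b2[of Y] by (auto intro!: N.integrable_const_bound[where B=1])
    \<comment> \<open>Subtracting \<open>A\<close> from \<open>B\<close> removes the constant 1 from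
      the weight and leaves the cosine.\<close>
    show ?case using A B unfolding split[OF i1] split[OF i2] by simp
  qed
  have P: "measure M {\<omega>\<in>space M. \<forall>j\<in>J. X j \<omega> \<in> A j} = measure N {\<omega>\<in>space N. \<forall>j\<in>J. Y j \<omega> \<in> A j}"
    if J: "finite J" and A: "\<And>j. A j \<in> sets borel" for J A
  proof -
    \<comment> \<open>Zero frequencies and zero phase make the cosine equal to 1, which leaves the
      probability of a cylinder.\<close>
    have ind: "(LINT \<omega>|K. (\<Prod>j\<in>J. indicator (A j) (Z j \<omega>)) * cos ((\<Sum>t\<in>J. 0 * Z t \<omega>) + 0))
       = measure K {\<omega>\<in>space K. \<forall>j\<in>J. Z j \<omega> \<in> A j}" for Z :: "'t \<Rightarrow> 'c \<Rightarrow> real" and K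
    proof -
      have "(LINT \<omega>|K. (\<Prod>j\<in>J. indicator (A j) (Z j \<omega>)) * cos ((\<Sum>t\<in>J. 0 * Z t \<omega>) + 0))
        = (LINT \<omega>|K. indicator {\<omega>\<in>space K. \<forall>j\<in>J. Z j \<omega> \<in> A j} \<omega> :: real)"
        using J by (intro Bochner_Integration.integral_cong) (auto simp: indicator_def prod.neutral)
      then show ?thesis by (simp add: Int_def conj_commute cong: conj_cong)
    qed
    show ?thesis using main[OF J J subset_refl, where A1=A and c1="\<lambda>_. 0" and a1=0, OF A] unfolding ind .
  qed
  show ?thesis
  proof (rule measure_eqI_PiM_infinite)
    show "finite_measure (distr M (\<Pi>\<^sub>M t\<in>UNIV. borel) (\<lambda>\<omega> t. X t \<omega>))"
      by (intro M.finite_measure_distr measurable_PiM_single') auto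
    fix A and J :: "'t set" assume J: "finite J" and A: "\<And>i. i \<in> J \<Longrightarrow> A i \<in> sets (borel :: real measure)"
    \<comment> \<open>The sets are known to be Borel only for indices in \<open>J\<close>, while
      \<open>P\<close> asks for it at every index.\<close>
    define A' where "A' j = (if j \<in> J then A j else {})" for j
    have em: "emeasure (distr K (\<Pi>\<^sub>M t\<in>UNIV. borel) (\<lambda>\<omega> t. Z t \<omega>))
        (prod_emb UNIV (\<lambda>_. borel) J (Pi\<^sub>E J A)) = emeasure K {\<omega>\<in>space K. \<forall>j\<in>J. Z j \<omega> \<in> A' j}"
      if [measurable]: "\<And>t. Z t \<in> borel_measurable K" for Z :: "'t \<Rightarrow> 'c \<Rightarrow> real" and K
    proof -
      have "prod_emb UNIV (\<lambda>_. borel) J (Pi\<^sub>E J A) \<in> sets (\<Pi>\<^sub>M t\<in>UNIV. borel)"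
        using J A by (intro sets_PiM_I) auto
      moreover have "(\<lambda>\<omega> t. Z t \<omega>) \<in> measurable K (\<Pi>\<^sub>M t\<in>UNIV. borel)"
        by (rule measurable_PiM_single') auto
      ultimately show ?thesis
        by (subst emeasure_distr)
          (auto intro!: arg_cong2[where f=emeasure] simp: prod_emb_def PiE_iff A'_def extensional_def space_PiM)
    qed
    show "emeasure (distr M (\<Pi>\<^sub>M t\<in>UNIV. borel) (\<lambda>\<omega> t. X t \<omega>)) (prod_emb UNIV (\<lambda>_. borel) J (Pi\<^sub>E J A))
      = emeasure (distr N (\<Pi>\<^sub>M t\<in>UNIV. borel) (\<lambda>\<omega> t. Y t \<omega>)) (prod_emb UNIV (\<lambda>_. borel) J (Pi\<^sub>E J A))"
      using P[OF J, of A'] A unfolding em[OF assms(3)] em[OF assms(4)]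
      by (simp add: M.emeasure_eq_measure N.emeasure_eq_measure A'_def)
  qed simp_all
qed

section \<open>Centered Gaussian spaces\<close>

text \<open>The substitution \<open>m + s * y\<close> reduces to the standard normal law, whose
  characteristic function is real: the sine moment vanishes and only the factor
  \<open>cos (k * m + a)\<close> survives.\<close>

lemma integral_normal_density_cos:
  assumes s: "s > 0"
  shows "(LINT y|lborel. normal_density m s y * cos (k * y + a)) = exp (- (k * s)\<^sup>2 / 2) * cos (k * m + a)"
proof -
  let ?n = "std_normal_density"
  have int: "complex_integrable lborel (\<lambda>y. ?n y *\<^sub>R iexp (t * y))" for t
    by (rule Bochner_Integration.integrable_bound[OF integrable_normal_density[of 1 0]]) auto
  have "(CLINT y|lborel. ?n y *\<^sub>R iexp (t * y)) = exp (- (t^2) / 2)" for t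
    using fun_cong[OF char_std_normal_distribution, of t]
    unfolding char_def by (simp add: integral_density)
  then have "Re (CLINT y|lborel. ?n y *\<^sub>R iexp (t * y)) = exp (- (t^2) / 2)"
    "Im (CLINT y|lborel. ?n y *\<^sub>R iexp (t * y)) = 0" for t by simp_all
  then have cs: "(LINT y|lborel. ?n y * cos (t * y)) = exp (- (t^2) / 2)"
      "(LINT y|lborel. ?n y * sin (t * y)) = 0" for t
    using integral_Re[OF int[of t]] integral_Im[OF int[of t]] by (simp_all add: Re_exp Im_exp)
  have int2: "integrable lborel (\<lambda>y. ?n y * cos (t * y))" "integrable lborel (\<lambda>y. ?n y * sin (t * y))" for t
    by (rule Bochner_Integration.integrable_bound[OF integrable_normal_density[of 1 0]];
        auto simp: abs_mult mult_left_le)+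
  have nd: "\<bar>s\<bar> * normal_density m s (m + s * y) = ?n y" for y
    using s by (simp add: normal_density_def real_sqrt_mult field_simps)
  have "(LINT y|lborel. normal_density m s y * cos (k * y + a))
      = \<bar>s\<bar> * (LINT y|lborel. normal_density m s (m + s * y) * cos (k * (m + s * y) + a))"
    using s by (subst lborel_integral_real_affine[where c=s and t=m]) auto
  also have "\<dots> = (LINT y|lborel. \<bar>s\<bar> * normal_density m s (m + s * y) * cos (k * (m + s * y) + a))"
    by (simp add: mult.assoc)
  also have "\<dots> = (LINT y|lborel. cos (k * m + a) * (?n y * cos ((k * s) * y)) - sin (k * m + a) * (?n y * sin ((k * s) * y)))"
  proof (intro Bochner_Integration.integral_cong refl)
    fix y
    have "k * (m + s * y) + a = (k * m + a) + (k * s) * y" by (simp add: algebra_simps)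
    then show "\<bar>s\<bar> * normal_density m s (m + s * y) * cos (k * (m + s * y) + a)
      = cos (k * m + a) * (?n y * cos ((k * s) * y)) - sin (k * m + a) * (?n y * sin ((k * s) * y))"
      unfolding nd by (simp only: cos_add) (simp add: algebra_simps)
  qed
  also have "\<dots> = cos (k * m + a) * exp (- (k * s)\<^sup>2 / 2)"
    using int2[of "k * s"] cs[of "k * s"] by simp
  finally show ?thesis by simp
qed

text \<open>The existential parameters of \<open>gaussian_rv\<close> are pinned down by the first
  two moments, so that later arguments can speak of second moments alone, with the point mass at 0
  as the degenerate case.\<close>

lemma (in prob_space) centered_gaussian_rv_cases:
  assumes G: "gaussian_rv M X" and E: "expectation X = 0"
  shows "integrable M (\<lambda>\<omega>. (X \<omega>)\<^sup>2)"
    and "(AE \<omega> in M. X \<omega> = 0) \<and> expectation (\<lambda>\<omega>. (X \<omega>)\<^sup>2) = 0 \<or>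
      expectation (\<lambda>\<omega>. (X \<omega>)\<^sup>2) > 0 \<and>
      distributed M lborel X (\<lambda>x. ennreal (normal_density 0 (sqrt (expectation (\<lambda>\<omega>. (X \<omega>)\<^sup>2))) x))"
proof -
  have [measurable]: "X \<in> borel_measurable M" using G by (simp add: gaussian_rv_def)
  consider m where "AE \<omega> in M. X \<omega> = m"
    | m s where "s > 0" "distributed M lborel X (\<lambda>x. ennreal (normal_density m s x))"
    using G by (auto simp: gaussian_rv_def)
  then have "integrable M (\<lambda>\<omega>. (X \<omega>)\<^sup>2) \<and> ((AE \<omega> in M. X \<omega> = 0) \<and> expectation (\<lambda>\<omega>. (X \<omega>)\<^sup>2) = 0 \<or>
      expectation (\<lambda>\<omega>. (X \<omega>)\<^sup>2) > 0 \<and>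
      distributed M lborel X (\<lambda>x. ennreal (normal_density 0 (sqrt (expectation (\<lambda>\<omega>. (X \<omega>)\<^sup>2))) x)))"
  proof cases
    case (1 m)
    have "expectation X = expectation (\<lambda>_. m)"
      using 1 by (intro integral_cong_AE) auto
    then have "m = 0" using E by (simp add: prob_space)
    with 1 have 0: "AE \<omega> in M. X \<omega> = 0" by simp
    have "integrable M (\<lambda>\<omega>. (X \<omega>)\<^sup>2) = integrable M (\<lambda>_. 0 :: real)"
      using 0 by (intro integrable_cong_AE) auto
    moreover have "expectation (\<lambda>\<omega>. (X \<omega>)\<^sup>2) = expectation (\<lambda>_. 0)"
      using 0 by (intro integral_cong_AE) auto
    ultimately show ?thesis using 0 by simp
  next
    case (2 m s)
    have m: "m = 0" using normal_distributed_expectation[OF 2] E by simp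
    have v: "expectation (\<lambda>\<omega>. (X \<omega>)\<^sup>2) = s\<^sup>2"
      using normal_distributed_variance[OF 2] E by simp
    have "integrable lborel (\<lambda>x. normal_density m s x * x\<^sup>2)"
      using integrable_normal_moment[OF 2(1), of m 2] m by simp
    then have "integrable M (\<lambda>\<omega>. (X \<omega>)\<^sup>2)"
      using distributed_integrable[OF 2(2), of "\<lambda>x. x\<^sup>2"] by simp
    then show ?thesis using 2 m v by (auto simp: real_sqrt_unique)
  qed
  then show "integrable M (\<lambda>\<omega>. (X \<omega>)\<^sup>2)"
    and "(AE \<omega> in M. X \<omega> = 0) \<and> expectation (\<lambda>\<omega>. (X \<omega>)\<^sup>2) = 0 \<or>
      expectation (\<lambda>\<omega>. (X \<omega>)\<^sup>2) > 0 \<and>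
      distributed M lborel X (\<lambda>x. ennreal (normal_density 0 (sqrt (expectation (\<lambda>\<omega>. (X \<omega>)\<^sup>2))) x))"
    by blast+
qed

text \<open>Closure under linear combinations reduces every trigonometric moment of a family in
  \<open>G\<close> to one variable in \<open>G\<close>, so that covariances determine all joint
  laws.\<close>

locale centered_gaussian_space = prob_space M for M :: "'a measure" +
  fixes G :: "('a \<Rightarrow> real) set"
  assumes gaussian_rv_G: "L \<in> G \<Longrightarrow> gaussian_rv M L"
    and expectation_G: "L \<in> G \<Longrightarrow> expectation L = 0"
    and zero_G: "(\<lambda>_. 0) \<in> G"
    and lincomb_G: "\<And>K L a b. K \<in> G \<Longrightarrow> L \<in> G \<Longrightarrow> (\<lambda>\<omega>. a * K \<omega> + b * L \<omega>) \<in> G"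
begin

lemma measurable_G [measurable_dest]: "L \<in> G \<Longrightarrow> L \<in> borel_measurable M"
  using gaussian_rv_G[of L] by (simp add: gaussian_rv_def)

lemma scale_G: "L \<in> G \<Longrightarrow> (\<lambda>\<omega>. a * L \<omega>) \<in> G"
  using lincomb_G[of L L a 0] by simp

lemma diff_G: "K \<in> G \<Longrightarrow> L \<in> G \<Longrightarrow> (\<lambda>\<omega>. K \<omega> - L \<omega>) \<in> G"
  using lincomb_G[of K L 1 "-1"] by simp

lemma sum_G: "finite S \<Longrightarrow> (\<And>t. t \<in> S \<Longrightarrow> Z t \<in> G) \<Longrightarrow> (\<lambda>\<omega>. \<Sum>t\<in>S. c t * Z t \<omega>) \<in> G"
proof (induction S rule: finite_induct)
  case (insert t S)
  then show ?case using lincomb_G[of "Z t" "\<lambda>\<omega>. \<Sum>t\<in>S. c t * Z t \<omega>" "c t" 1] by simp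
qed (simp add: zero_G)

lemma integrable_square: "L \<in> G \<Longrightarrow> integrable M (\<lambda>\<omega>. (L \<omega>)\<^sup>2)"
  by (intro centered_gaussian_rv_cases(1) gaussian_rv_G expectation_G)

lemma integrable_mult: 
  assumes [measurable]: "K \<in> G" "L \<in> G"
  shows "integrable M (\<lambda>\<omega>. K \<omega> * L \<omega>)"
proof (rule Bochner_Integration.integrable_bound)
  show "integrable M (\<lambda>\<omega>. (K \<omega>)\<^sup>2 + (L \<omega>)\<^sup>2)"
    by (intro Bochner_Integration.integrable_add integrable_square assms)
  show "AE \<omega> in M. norm (K \<omega> * L \<omega>) \<le> norm ((K \<omega>)\<^sup>2 + (L \<omega>)\<^sup>2)"
  proof (rule AE_I2)
    fix \<omega>
    have "2 * (\<bar>K \<omega>\<bar> * \<bar>L \<omega>\<bar>) \<le> (K \<omega>)\<^sup>2 + (L \<omega>)\<^sup>2"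
      using sum_squares_bound[of "\<bar>K \<omega>\<bar>" "\<bar>L \<omega>\<bar>"] by simp
    moreover have "0 \<le> \<bar>K \<omega>\<bar> * \<bar>L \<omega>\<bar>" by simp
    ultimately show "norm (K \<omega> * L \<omega>) \<le> norm ((K \<omega>)\<^sup>2 + (L \<omega>)\<^sup>2)"
      unfolding real_norm_def abs_mult by linarith
  qed
qed measurable

lemma expectation_cos:
  assumes L [measurable]: "L \<in> G"
  shows "expectation (\<lambda>\<omega>. cos (L \<omega> + a)) = exp (- expectation (\<lambda>\<omega>. (L \<omega>)\<^sup>2) / 2) * cos a"
  using centered_gaussian_rv_cases(2)[OF gaussian_rv_G[OF L] expectation_G[OF L]]
proof (elim disjE conjE)
  assume 0: "AE \<omega> in M. L \<omega> = 0" and v: "expectation (\<lambda>\<omega>. (L \<omega>)\<^sup>2) = 0"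
  have "expectation (\<lambda>\<omega>. cos (L \<omega> + a)) = expectation (\<lambda>\<omega>. cos a)"
    using 0 by (intro integral_cong_AE) auto
  then show ?thesis using v by (simp add: prob_space)
next
  let ?v = "expectation (\<lambda>\<omega>. (L \<omega>)\<^sup>2)"
  assume v: "?v > 0" and D: "distributed M lborel L (\<lambda>x. ennreal (normal_density 0 (sqrt ?v) x))"
  show ?thesis
    using distributed_integral[OF D, of "\<lambda>x. cos (x + a)"] v
      integral_normal_density_cos[of "sqrt ?v" 0 1 a] by simp
qed

lemma expectation_square_lincomb:
  assumes K: "K \<in> G" and L: "L \<in> G"
  shows "expectation (\<lambda>\<omega>. (a * K \<omega> + b * L \<omega>)\<^sup>2) = a\<^sup>2 * expectation (\<lambda>\<omega>. (K \<omega>)\<^sup>2)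
     + 2 * a * b * expectation (\<lambda>\<omega>. K \<omega> * L \<omega>) + b\<^sup>2 * expectation (\<lambda>\<omega>. (L \<omega>)\<^sup>2)"
proof -
  have "expectation (\<lambda>\<omega>. (a * K \<omega> + b * L \<omega>)\<^sup>2)
     = expectation (\<lambda>\<omega>. a\<^sup>2 * (K \<omega>)\<^sup>2 + 2 * a * b * (K \<omega> * L \<omega>) + b\<^sup>2 * (L \<omega>)\<^sup>2)"
    by (intro Bochner_Integration.integral_cong) (auto simp: power2_eq_square algebra_simps)
  also have "\<dots> = a\<^sup>2 * expectation (\<lambda>\<omega>. (K \<omega>)\<^sup>2)
     + 2 * a * b * expectation (\<lambda>\<omega>. K \<omega> * L \<omega>) + b\<^sup>2 * expectation (\<lambda>\<omega>. (L \<omega>)\<^sup>2)"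
    using integrable_square[OF K] integrable_square[OF L] integrable_mult[OF K L] by simp
  finally show ?thesis .
qed

lemma expectation_mult_sum:
  assumes "finite S" "finite T" "\<And>s. s \<in> S \<Longrightarrow> X s \<in> G" "\<And>s. s \<in> T \<Longrightarrow> Y s \<in> G"
  shows "expectation (\<lambda>\<omega>. (\<Sum>s\<in>S. c s * X s \<omega>) * (\<Sum>t\<in>T. d t * Y t \<omega>))
    = (\<Sum>s\<in>S. \<Sum>t\<in>T. c s * d t * expectation (\<lambda>\<omega>. X s \<omega> * Y t \<omega>))"
proof -
  have "expectation (\<lambda>\<omega>. (\<Sum>s\<in>S. c s * X s \<omega>) * (\<Sum>t\<in>T. d t * Y t \<omega>))
     = expectation (\<lambda>\<omega>. \<Sum>s\<in>S. \<Sum>t\<in>T. (c s * d t) * (X s \<omega> * Y t \<omega>))"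
    unfolding sum_product by (intro Bochner_Integration.integral_cong refl sum.cong) simp
  also have "\<dots> = (\<Sum>s\<in>S. \<Sum>t\<in>T. c s * d t * expectation (\<lambda>\<omega>. X s \<omega> * Y t \<omega>))"
    using assms by (simp add: Bochner_Integration.integral_sum integrable_mult)
  finally show ?thesis .
qed

lemma integrable_exp:
  assumes Y [measurable]: "Y \<in> G"
  shows "integrable M (\<lambda>\<omega>. exp (Y \<omega>))"
  using centered_gaussian_rv_cases(2)[OF gaussian_rv_G[OF Y] expectation_G[OF Y]]
proof (elim disjE conjE)
  assume 0: "AE \<omega> in M. Y \<omega> = 0" 
  have "integrable M (\<lambda>\<omega>. exp (Y \<omega>)) = integrable M (\<lambda>\<omega>. 1 :: real)"
    using 0 by (intro integrable_cong_AE) auto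
  then show ?thesis by simp
next
  let ?v = "expectation (\<lambda>\<omega>. (Y \<omega>)\<^sup>2)"
  assume v: "?v > 0" and D: "distributed M lborel Y (\<lambda>x. ennreal (normal_density 0 (sqrt ?v) x))"
  \<comment> \<open>Completing the square: the weight \<open>exp\<close> moves the mean from 0 to
    the variance.\<close>
  have nd: "normal_density 0 (sqrt ?v) x * exp x = exp (?v / 2) * normal_density ?v (sqrt ?v) x" for x
    using v by (simp add: normal_density_def field_simps power2_eq_square flip: exp_add)
  show ?thesis
    using distributed_integrable[OF D, of exp] integrable_normal_density[of "sqrt ?v" ?v] v
    by (simp add: nd)
qed

text \<open>Write \<open>L = \<kappa> Y + R\<close> with \<open>R\<close> uncorrelated with \<open>Y\<close>. Conditioning on \<open>Y\<close> then amounts to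
  replacing the weight \<open>1 + cos (L + a)\<close> by its projection \<open>1 + exp (- Var R / 2) cos (\<kappa> Y + a)\<close>,
  which is justified by comparing characteristic functions of the weighted laws of \<open>Y\<close>.\<close>

lemma expectation_exp_cos:
  assumes Y [measurable]: "Y \<in> G" and L [measurable]: "L \<in> G"
  shows "expectation (\<lambda>\<omega>. exp (Y \<omega>) * cos (L \<omega> + a))
    = exp (expectation (\<lambda>\<omega>. (Y \<omega>)\<^sup>2) / 2 - expectation (\<lambda>\<omega>. (L \<omega>)\<^sup>2) / 2)
      * cos (expectation (\<lambda>\<omega>. Y \<omega> * L \<omega>) + a)"
  using centered_gaussian_rv_cases(2)[OF gaussian_rv_G[OF Y] expectation_G[OF Y]]
proof (elim disjE conjE)
  assume 0: "AE \<omega> in M. Y \<omega> = 0" and v: "expectation (\<lambda>\<omega>. (Y \<omega>)\<^sup>2) = 0"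
  have "expectation (\<lambda>\<omega>. exp (Y \<omega>) * cos (L \<omega> + a)) = expectation (\<lambda>\<omega>. cos (L \<omega> + a))"
    using 0 by (intro integral_cong_AE) auto
  moreover have "expectation (\<lambda>\<omega>. Y \<omega> * L \<omega>) = expectation (\<lambda>\<omega>. 0)"
    using 0 by (intro integral_cong_AE) auto
  ultimately show ?thesis using v by (simp add: expectation_cos[OF L])
next
  let ?v = "expectation (\<lambda>\<omega>. (Y \<omega>)\<^sup>2)" and ?c = "expectation (\<lambda>\<omega>. Y \<omega> * L \<omega>)"
    and ?l = "expectation (\<lambda>\<omega>. (L \<omega>)\<^sup>2)"
  assume v: "?v > 0" and D: "distributed M lborel Y (\<lambda>x. ennreal (normal_density 0 (sqrt ?v) x))"
  define \<kappa> where "\<kappa> = ?c / ?v"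
  have \<kappa>v: "\<kappa> * ?v = ?c" using v by (simp add: \<kappa>_def)
  define r where "r = ?l - \<kappa>\<^sup>2 * ?v"
  have "0 \<le> expectation (\<lambda>\<omega>. ((-\<kappa>) * Y \<omega> + 1 * L \<omega>)\<^sup>2)" by simp
  then have r: "r \<ge> 0"
    unfolding expectation_square_lincomb[OF Y L] r_def \<kappa>v[symmetric] by (simp add: power2_eq_square)
  let ?e = "exp (- r / 2)"
  let ?w = "\<lambda>\<omega>. 1 + cos (L \<omega> + a)" and ?u = "\<lambda>\<omega>. 1 + ?e * cos (\<kappa> * Y \<omega> + a)"
  \<comment> \<open>\<open>r\<close> is the second moment of the residual
    \<open>L - \<kappa> * Y\<close>; its sign keeps the projected weight \<open>?u\<close>
    nonnegative, as a density must be.\<close>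
  have e1: "?e \<le> 1" "?e \<ge> 0" using r by auto
  have bd: "\<bar>?e * cos t\<bar> \<le> 1" for t
    unfolding abs_mult using e1 by (intro mult_le_one) auto
  have intc: "integrable M (\<lambda>\<omega>. cos (f \<omega>))" if [measurable]: "f \<in> borel_measurable M" for f :: "'a \<Rightarrow> real"
    by (rule integrable_const_bound[where B=1]) auto
  have wu: "expectation (\<lambda>\<omega>. ?w \<omega> * exp (Y \<omega>)) = expectation (\<lambda>\<omega>. ?u \<omega> * exp (Y \<omega>))"
  proof (rule integral_weight_eqI[where w="?w" and v="?u" and X=Y and Y=Y and g=exp])
    fix \<theta> b
    \<comment> \<open>The variable is \<open>(\<kappa> + \<theta>') * Y\<close> plus the
      uncorrelated residual, which contributes only the factor \<open>exp (- r / 2)\<close>.\<close>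
    have A: "expectation (\<lambda>\<omega>. cos (\<theta>' * Y \<omega> + 1 * L \<omega> + b')) = exp (- ((\<kappa> + \<theta>')\<^sup>2 * ?v + r) / 2) * cos b'" for \<theta>' b'
      unfolding expectation_cos[OF lincomb_G[OF Y L]] expectation_square_lincomb[OF Y L] r_def \<kappa>v[symmetric]
      by (simp add: power2_eq_square algebra_simps)
    have B: "expectation (\<lambda>\<omega>. cos (\<theta>' * Y \<omega> + b')) = exp (- (\<theta>'\<^sup>2 * ?v) / 2) * cos b'" for \<theta>' b'
      using expectation_cos[OF scale_G[OF Y], of \<theta>' b'] by (simp add: power_mult_distrib)
    have e: "exp (- (x + r) / 2) = exp (- x / 2) * ?e" for x
      by (simp add: diff_divide_distrib flip: exp_add)
    have prod: "cos x * cos y = (1/2) * cos (x - y) + (1/2) * cos (x + y)" for x y :: real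
      by (simp add: cos_times_cos)
    have "expectation (\<lambda>\<omega>. ?w \<omega> * cos (\<theta> * Y \<omega> + b))
      = expectation (\<lambda>\<omega>. cos (\<theta> * Y \<omega> + b) + ((1/2) * cos ((-\<theta>) * Y \<omega> + 1 * L \<omega> + (a - b))
          + (1/2) * cos (\<theta> * Y \<omega> + 1 * L \<omega> + (a + b))))"
      by (intro Bochner_Integration.integral_cong refl, unfold distrib_right prod) (simp add: algebra_simps)
    also have "\<dots> = expectation (\<lambda>\<omega>. cos (\<theta> * Y \<omega> + b)) + ((1/2) * expectation (\<lambda>\<omega>. cos ((-\<theta>) * Y \<omega> + 1 * L \<omega> + (a - b)))
          + (1/2) * expectation (\<lambda>\<omega>. cos (\<theta> * Y \<omega> + 1 * L \<omega> + (a + b))))"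
      by (subst Bochner_Integration.integral_add, (intro Bochner_Integration.integrable_add integrable_mult_right intc; measurable),
          (intro Bochner_Integration.integrable_add integrable_mult_right intc; measurable))+
        (simp only: integral_mult_right_zero)
    also have "\<dots> = expectation (\<lambda>\<omega>. cos (\<theta> * Y \<omega> + b)) + ((1/2) * ?e * expectation (\<lambda>\<omega>. cos ((\<kappa> - \<theta>) * Y \<omega> + (a - b)))
          + (1/2) * ?e * expectation (\<lambda>\<omega>. cos ((\<kappa> + \<theta>) * Y \<omega> + (a + b))))"
      unfolding A B e by (simp add: mult_ac)
    also have "\<dots> = expectation (\<lambda>\<omega>. cos (\<theta> * Y \<omega> + b) + ((1/2) * ?e * cos ((\<kappa> - \<theta>) * Y \<omega> + (a - b))
          + (1/2) * ?e * cos ((\<kappa> + \<theta>) * Y \<omega> + (a + b))))"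
      by (subst Bochner_Integration.integral_add, (intro Bochner_Integration.integrable_add integrable_mult_right intc; measurable),
          (intro Bochner_Integration.integrable_add integrable_mult_right intc; measurable))+
        (simp only: integral_mult_right_zero)
    also have "\<dots> = expectation (\<lambda>\<omega>. ?u \<omega> * cos (\<theta> * Y \<omega> + b))"
      by (intro Bochner_Integration.integral_cong refl, unfold distrib_right mult.assoc prod) (simp add: algebra_simps)
    finally show "expectation (\<lambda>\<omega>. ?w \<omega> * cos (\<theta> * Y \<omega> + b)) = expectation (\<lambda>\<omega>. ?u \<omega> * cos (\<theta> * Y \<omega> + b))" .
  next
    show "0 \<le> ?w \<omega>" for \<omega> using cos_ge_minus_one[of "L \<omega> + a"] by linarith
    show "0 \<le> ?u \<omega>" for \<omega> using bd[of "\<kappa> * Y \<omega> + a"] by linarith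
  qed (auto intro!: intc Bochner_Integration.integrable_add integrable_mult_right)
  have ie: "integrable M (\<lambda>\<omega>. exp (Y \<omega>))" by (rule integrable_exp[OF Y])
  have iec: "integrable M (\<lambda>\<omega>. exp (Y \<omega>) * cos (f \<omega>))" if [measurable]: "f \<in> borel_measurable M" for f :: "'a \<Rightarrow> real"
    by (rule Bochner_Integration.integrable_bound[OF ie]) (auto simp: abs_mult mult_left_le)
  have 1: "expectation (\<lambda>\<omega>. ?w \<omega> * exp (Y \<omega>)) = expectation (\<lambda>\<omega>. exp (Y \<omega>)) + expectation (\<lambda>\<omega>. exp (Y \<omega>) * cos (L \<omega> + a))"
    by (subst Bochner_Integration.integral_add[symmetric]) (auto intro!: ie iec simp: algebra_simps)
  have 2: "expectation (\<lambda>\<omega>. ?u \<omega> * exp (Y \<omega>)) = expectation (\<lambda>\<omega>. exp (Y \<omega>)) + ?e * expectation (\<lambda>\<omega>. exp (Y \<omega>) * cos (\<kappa> * Y \<omega> + a))"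
  proof -
    have "expectation (\<lambda>\<omega>. ?u \<omega> * exp (Y \<omega>)) = expectation (\<lambda>\<omega>. exp (Y \<omega>) + ?e * (exp (Y \<omega>) * cos (\<kappa> * Y \<omega> + a)))"
      by (intro Bochner_Integration.integral_cong refl) (simp add: algebra_simps)
    also have "\<dots> = expectation (\<lambda>\<omega>. exp (Y \<omega>)) + ?e * expectation (\<lambda>\<omega>. exp (Y \<omega>) * cos (\<kappa> * Y \<omega> + a))"
      unfolding integral_mult_right_zero[symmetric]
      by (intro Bochner_Integration.integral_add ie integrable_mult_right iec) measurable
    finally show ?thesis .
  qed
  have nd: "normal_density 0 (sqrt ?v) x * exp x = exp (?v / 2) * normal_density ?v (sqrt ?v) x" for x
    using v by (simp add: normal_density_def field_simps power2_eq_square flip: exp_add)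
  have "expectation (\<lambda>\<omega>. exp (Y \<omega>) * cos (\<kappa> * Y \<omega> + a))
      = (LINT y|lborel. normal_density 0 (sqrt ?v) y * (exp y * cos (\<kappa> * y + a)))"
    using distributed_integral[OF D, of "\<lambda>y. exp y * cos (\<kappa> * y + a)"] by simp
  also have "\<dots> = (LINT y|lborel. exp (?v / 2) * (normal_density ?v (sqrt ?v) y * cos (\<kappa> * y + a)))"
    by (simp add: nd flip: mult.assoc)
  also have "\<dots> = exp (?v / 2) * (exp (- (\<kappa>\<^sup>2 * ?v) / 2) * cos (?c + a))"
    using integral_normal_density_cos[of "sqrt ?v" ?v \<kappa> a] v \<kappa>v by (simp add: power_mult_distrib)
  finally have 3: "expectation (\<lambda>\<omega>. exp (Y \<omega>) * cos (\<kappa> * Y \<omega> + a)) = exp (?v / 2) * (exp (- (\<kappa>\<^sup>2 * ?v) / 2) * cos (?c + a))" .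
  have "expectation (\<lambda>\<omega>. exp (Y \<omega>) * cos (L \<omega> + a)) = ?e * (exp (?v / 2) * (exp (- (\<kappa>\<^sup>2 * ?v) / 2) * cos (?c + a)))"
    using wu unfolding 1 2 3 by simp
  also have "\<dots> = exp (- r / 2 + ?v / 2 + - (\<kappa>\<^sup>2 * ?v) / 2) * cos (?c + a)"
    by (simp only: exp_add mult.assoc)
  also have "- r / 2 + ?v / 2 + - (\<kappa>\<^sup>2 * ?v) / 2 = ?v / 2 - ?l / 2"
    by (simp add: r_def field_simps)
  finally show ?thesis .
qed

lemma expectation_exp:
  "Y \<in> G \<Longrightarrow> expectation (\<lambda>\<omega>. exp (Y \<omega>)) = exp (expectation (\<lambda>\<omega>. (Y \<omega>)\<^sup>2) / 2)"
  using expectation_exp_cos[of Y "\<lambda>_. 0" 0] by (simp add: zero_G)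

end

section \<open>Change of measure\<close>

context centered_gaussian_space
begin

text \<open>Cosine moments of centered Gaussian combinations depend only on their variances, which
  are bilinear in the covariances.\<close>

lemma distr_eqI_covariance:
  fixes X Y :: "'t \<Rightarrow> 'a \<Rightarrow> real"
  assumes X: "\<And>t. X t \<in> G" and Y: "\<And>t. Y t \<in> G"
    and cov: "\<And>s t. expectation (\<lambda>\<omega>. X s \<omega> * X t \<omega>) = expectation (\<lambda>\<omega>. Y s \<omega> * Y t \<omega>)"
  shows "distr M (\<Pi>\<^sub>M t\<in>UNIV. borel) (\<lambda>\<omega> t. X t \<omega>) = distr M (\<Pi>\<^sub>M t\<in>UNIV. borel) (\<lambda>\<omega> t. Y t \<omega>)"
proof (rule distr_PiM_eqI_cos)
  fix S :: "'t set" and c and a :: real assume S: "finite S"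
  show "expectation (\<lambda>\<omega>. cos ((\<Sum>t\<in>S. c t * X t \<omega>) + a)) = expectation (\<lambda>\<omega>. cos ((\<Sum>t\<in>S. c t * Y t \<omega>) + a))"
    using S X Y cov by (simp add: expectation_cos sum_G power2_eq_square expectation_mult_sum)
qed (use X Y prob_space_axioms in auto)

text \<open>Under the density \<open>exp (Y - Var Y / 2)\<close> each member of \<open>G\<close> is
  shifted by its covariance with \<open>Y\<close> and keeps its covariances;
  \<open>expectation_exp_cos\<close> shows this for cosine moments. Leaving \<open>V\<close> free,
  subject only to its covariance, lets a change of time parameter be absorbed in the same step. The
  nonnegative integral admits unbounded functionals such as suprema.\<close>

lemma nn_integral_cameron_martin:
  fixes U V :: "'t \<Rightarrow> 'a \<Rightarrow> real"
  assumes Y [measurable]: "Y \<in> G" and U: "\<And>t. U t \<in> G" and V: "\<And>t. V t \<in> G"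
    and cov: "\<And>s t. expectation (\<lambda>\<omega>. U s \<omega> * U t \<omega>) = expectation (\<lambda>\<omega>. V s \<omega> * V t \<omega>)"
    and F [measurable]: "F \<in> borel_measurable (\<Pi>\<^sub>M t\<in>UNIV. borel)"
  shows "(\<integral>\<^sup>+\<omega>. ennreal (exp (Y \<omega> - expectation (\<lambda>\<omega>. (Y \<omega>)\<^sup>2) / 2)) *
      F (\<lambda>t. U t \<omega> - expectation (\<lambda>\<omega>. Y \<omega> * U t \<omega>)) \<partial>M) = (\<integral>\<^sup>+\<omega>. F (\<lambda>t. V t \<omega>) \<partial>M)"
proof -
  note [measurable] = measurable_G[OF U] measurable_G[OF V]
  define v where "v = expectation (\<lambda>\<omega>. (Y \<omega>)\<^sup>2)"
  define m where "m t = expectation (\<lambda>\<omega>. Y \<omega> * U t \<omega>)" for t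
  let ?N = "density M (\<lambda>\<omega>. ennreal (exp (Y \<omega> - v / 2)))"
  have split: "exp (Y \<omega> - v / 2) = exp (- v / 2) * exp (Y \<omega>)" for \<omega>
    by (simp flip: exp_add)
  have ie: "integrable M (\<lambda>\<omega>. exp (Y \<omega> - v / 2))"
    unfolding split by (intro integrable_mult_right integrable_exp Y)
  have "expectation (\<lambda>\<omega>. exp (Y \<omega> - v / 2)) = 1"
    unfolding split integral_mult_right_zero expectation_exp[OF Y] v_def[symmetric]
    by (simp flip: exp_add)
  then have "(\<integral>\<^sup>+\<omega>. ennreal (exp (Y \<omega> - v / 2)) \<partial>M) = 1"
    using ie by (subst nn_integral_eq_integral) auto
  then have N: "prob_space ?N"
    by (intro prob_spaceI) (simp add: emeasure_density cong: nn_integral_cong)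
  have "distr ?N (\<Pi>\<^sub>M t\<in>UNIV. borel) (\<lambda>\<omega> t. U t \<omega> - m t) = distr M (\<Pi>\<^sub>M t\<in>UNIV. borel) (\<lambda>\<omega> t. V t \<omega>)"
  proof (rule distr_PiM_eqI_cos[OF N prob_space_axioms])
    fix S :: "'t set" and c and a :: real assume S: "finite S"
    define L where "L \<omega> = (\<Sum>t\<in>S. c t * U t \<omega>)" for \<omega>
    have L [measurable]: "L \<in> G" unfolding L_def[abs_def] using S U by (intro sum_G)
    have YL: "expectation (\<lambda>\<omega>. Y \<omega> * L \<omega>) = (\<Sum>t\<in>S. c t * m t)"
      using expectation_mult_sum[of "{()}" S "\<lambda>_. Y" U "\<lambda>_. 1" c] S U Y
      by (simp add: L_def m_def)
    have *: "(\<Sum>t\<in>S. c t * (U t \<omega> - m t)) + a = L \<omega> + (a - (\<Sum>t\<in>S. c t * m t))" for \<omega>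
      by (simp add: L_def right_diff_distrib sum_subtractf)
    have "(LINT \<omega>|?N. cos ((\<Sum>t\<in>S. c t * (U t \<omega> - m t)) + a))
      = expectation (\<lambda>\<omega>. exp (- v / 2) * (exp (Y \<omega>) * cos (L \<omega> + (a - (\<Sum>t\<in>S. c t * m t)))))"
      unfolding * by (simp add: integral_density split mult.assoc)
    also have "\<dots> = exp (- v / 2) * (exp (v / 2 - expectation (\<lambda>\<omega>. (L \<omega>)\<^sup>2) / 2) * cos a)"
      unfolding integral_mult_right_zero expectation_exp_cos[OF Y L] by (simp add: YL v_def)
    also have "\<dots> = exp (- expectation (\<lambda>\<omega>. (L \<omega>)\<^sup>2) / 2) * cos a"
      by (simp flip: exp_add mult.assoc)
    also have "expectation (\<lambda>\<omega>. (L \<omega>)\<^sup>2) = expectation (\<lambda>\<omega>. (\<Sum>t\<in>S. c t * V t \<omega>)\<^sup>2)"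
      unfolding L_def power2_eq_square using S U V cov by (simp add: expectation_mult_sum)
    also have "exp (- \<dots> / 2) * cos a = expectation (\<lambda>\<omega>. cos ((\<Sum>t\<in>S. c t * V t \<omega>) + a))"
      using S V by (simp add: expectation_cos sum_G)
    finally show "(LINT \<omega>|?N. cos ((\<Sum>t\<in>S. c t * (U t \<omega> - m t)) + a)) =
      expectation (\<lambda>\<omega>. cos ((\<Sum>t\<in>S. c t * V t \<omega>) + a))" .
  qed auto
  then have "(\<integral>\<^sup>+x. F x \<partial>distr ?N (\<Pi>\<^sub>M t\<in>UNIV. borel) (\<lambda>\<omega> t. U t \<omega> - m t))
     = (\<integral>\<^sup>+x. F x \<partial>distr M (\<Pi>\<^sub>M t\<in>UNIV. borel) (\<lambda>\<omega> t. V t \<omega>))" by simp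
  moreover have [measurable]: "(\<lambda>\<omega> t. U t \<omega> - m t) \<in> measurable M (\<Pi>\<^sub>M t\<in>UNIV. borel)"
     "(\<lambda>\<omega> t. V t \<omega>) \<in> measurable M (\<Pi>\<^sub>M t\<in>UNIV. borel)"
    by (auto intro!: measurable_PiM_single')
  ultimately show ?thesis
    by (simp add: nn_integral_distr nn_integral_density v_def m_def)
qed

end

section \<open>Covariance of fractional Brownian motion and the tilt by
  \<open>exp (Z t)\<close>\<close>

context standard_fbm
begin

lemma measurable_B [measurable]: "B t \<in> borel_measurable M"
  using gaussian[unfolded gaussian_process_def, rule_format, of "{t}" "\<lambda>_. 1"]
  by (simp add: gaussian_rv_def)

lemma integrable_B_square: "integrable M (\<lambda>\<omega>. (B t \<omega>)\<^sup>2)"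
proof (rule centered_gaussian_rv_cases(1))
  show "gaussian_rv M (B t)"
    using gaussian[unfolded gaussian_process_def, rule_format, of "{t}" "\<lambda>_. 1"] by simp
qed (rule centered)

lemma integrable_B: "integrable M (B t)"
  by (rule square_integrable_imp_integrable[OF measurable_B integrable_B_square])

definition span_B :: "('a \<Rightarrow> real) set" where
  "span_B = {L. \<exists>S c. finite S \<and> L = (\<lambda>\<omega>. \<Sum>t\<in>S. c t * B t \<omega>)}"

sublocale centered_gaussian_space M span_B
proof
  fix L assume "L \<in> span_B"
  then show "gaussian_rv M L" "expectation L = 0"
    using gaussian integrable_B centered by (auto simp: span_B_def gaussian_process_def)
next
  show "(\<lambda>_. 0) \<in> span_B" by (auto simp: span_B_def intro!: exI[of _ "{}"])
next
  fix K L a b assume "K \<in> span_B" "L \<in> span_B"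
  then obtain S c T d where S: "finite S" "K = (\<lambda>\<omega>. \<Sum>t\<in>S. c t * B t \<omega>)"
    and T: "finite T" "L = (\<lambda>\<omega>. \<Sum>t\<in>T. d t * B t \<omega>)"
    by (auto simp: span_B_def)
  let ?e = "\<lambda>t. a * (if t \<in> S then c t else 0) + b * (if t \<in> T then d t else 0)"
  have "a * K \<omega> + b * L \<omega> = (\<Sum>t\<in>S \<union> T. ?e t * B t \<omega>)" for \<omega>
  proof -
    have "(\<Sum>t\<in>S. c t * B t \<omega>) = (\<Sum>t\<in>S \<union> T. (if t \<in> S then c t else 0) * B t \<omega>)"
      using S(1) T(1) by (intro sum.mono_neutral_cong_left) auto
    moreover have "(\<Sum>t\<in>T. d t * B t \<omega>) = (\<Sum>t\<in>S \<union> T. (if t \<in> T then d t else 0) * B t \<omega>)"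
      using S(1) T(1) by (intro sum.mono_neutral_cong_left) auto
    ultimately show ?thesis
      unfolding S(2) T(2) by (simp add: distrib_right sum.distrib sum_distrib_left mult.assoc)
  qed
  then show "(\<lambda>\<omega>. a * K \<omega> + b * L \<omega>) \<in> span_B"
    using S(1) T(1) unfolding span_B_def by (intro CollectI exI[of _ "S \<union> T"] exI[of _ ?e]) auto
qed

lemma B_in_span [simp]: "B t \<in> span_B"
  unfolding span_B_def by (intro CollectI exI[of _ "{t}"] exI[of _ "\<lambda>_. 1"]) auto

lemma expectation_B_square: "expectation (\<lambda>\<omega>. (B t \<omega>)\<^sup>2) = \<bar>t\<bar> powr \<alpha>"
  using variance[of t] by (simp add: centered)

text \<open>Stationarity is an equality of laws on path space; it is evaluated at the coordinate
  \<open>s - t\<close>.\<close>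

lemma expectation_increment_square: "expectation (\<lambda>\<omega>. (B s \<omega> - B t \<omega>)\<^sup>2) = \<bar>s - t\<bar> powr \<alpha>"
proof -
  let ?f = "\<lambda>x :: real \<Rightarrow> real. (x (s - t))\<^sup>2"
  have [measurable]: "(\<lambda>\<omega> r. B (r + t) \<omega> - B t \<omega>) \<in> measurable M (\<Pi>\<^sub>M t\<in>UNIV. borel)"
    "(\<lambda>\<omega> r. B r \<omega> - B 0 \<omega>) \<in> measurable M (\<Pi>\<^sub>M t\<in>UNIV. borel)"
    by (auto intro!: measurable_PiM_single')
  have "expectation (\<lambda>\<omega>. (B s \<omega> - B t \<omega>)\<^sup>2)
      = (LINT x|distr M (\<Pi>\<^sub>M t\<in>UNIV. borel) (\<lambda>\<omega> r. B (r + t) \<omega> - B t \<omega>). ?f x)"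
    by (subst integral_distr) auto
  also have "\<dots> = (LINT x|distr M (\<Pi>\<^sub>M t\<in>UNIV. borel) (\<lambda>\<omega> r. B r \<omega> - B 0 \<omega>). ?f x)"
    using stationary by (simp add: stationary_increments_def)
  also have "\<dots> = expectation (\<lambda>\<omega>. (B (s - t) \<omega> - B 0 \<omega>)\<^sup>2)"
    by (subst integral_distr) auto
  also have "\<dots> = expectation (\<lambda>\<omega>. (B (s - t) \<omega>)\<^sup>2)"
    by (intro Bochner_Integration.integral_cong) (auto simp: starts_at_0)
  finally show ?thesis by (simp add: expectation_B_square)
qed

lemma covariance_B:
  "expectation (\<lambda>\<omega>. B s \<omega> * B t \<omega>) = (\<bar>s\<bar> powr \<alpha> + \<bar>t\<bar> powr \<alpha> - \<bar>s - t\<bar> powr \<alpha>) / 2"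
  using expectation_square_lincomb[OF B_in_span B_in_span, of 1 s "-1" t] expectation_increment_square[of s t]
  by (simp add: expectation_B_square)

text \<open>The drift is half the variance of \<open>sqrt 2 * B t\<close>, which gives
  \<open>exp (Z t)\<close> expectation 1.\<close>

definition Z :: "real \<Rightarrow> 'a \<Rightarrow> real" where
  "Z t \<omega> = sqrt 2 * B t \<omega> - \<bar>t\<bar> powr \<alpha>"

lemma measurable_Z [measurable]: "Z t \<in> borel_measurable M"
  unfolding Z_def[abs_def] by measurable

text \<open>Cameron-Martin with \<open>Y = sqrt 2 * B t\<close> shifts
  \<open>sqrt 2 * (B s - B t)\<close> by \<open>\<bar>s\<bar> powr \<alpha> - \<bar>t\<bar> powr
  \<alpha> - \<bar>s - t\<bar> powr \<alpha>\<close>. The first two terms cancel against the drift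
  of \<open>Z s - Z t\<close>, and the third is the drift of \<open>Z (s - t)\<close>. The
  increments from time \<open>t\<close> have the covariance of \<open>B (s - t)\<close>.\<close>

lemma nn_integral_shift:
  assumes F [measurable]: "F \<in> borel_measurable (\<Pi>\<^sub>M t\<in>UNIV. borel)"
  shows "(\<integral>\<^sup>+\<omega>. ennreal (exp (Z t \<omega>)) * F (\<lambda>s. Z s \<omega> - Z t \<omega>) \<partial>M) = (\<integral>\<^sup>+\<omega>. F (\<lambda>s. Z (s - t) \<omega>) \<partial>M)"
proof -
  let ?Y = "\<lambda>\<omega>. sqrt 2 * B t \<omega>"
  let ?U = "\<lambda>s \<omega>. sqrt 2 * (B s \<omega> - B t \<omega>)" and ?V = "\<lambda>s \<omega>. sqrt 2 * B (s - t) \<omega>"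
  let ?F = "\<lambda>x. F (\<lambda>s. x s - \<bar>s - t\<bar> powr \<alpha>)"
  have [measurable]: "(\<lambda>x s. x s - \<bar>s - t\<bar> powr \<alpha>) \<in> measurable (\<Pi>\<^sub>M t\<in>UNIV. borel) (\<Pi>\<^sub>M t\<in>UNIV. borel)"
    by (auto intro!: measurable_PiM_single')
  have s2: "(sqrt 2 * x) * (sqrt 2 * y) = 2 * (x * y)" for x y :: real
  proof -
    have "(sqrt 2 * x) * (sqrt 2 * y) = (sqrt 2 * sqrt 2) * (x * y)" by (simp only: mult_ac)
    then show ?thesis by simp
  qed
  have cov_inc: "expectation (\<lambda>\<omega>. (B r \<omega> - B t \<omega>) * (B s \<omega> - B t \<omega>)) = expectation (\<lambda>\<omega>. B (r - t) \<omega> * B (s - t) \<omega>)" for r s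
  proof -
    have "expectation (\<lambda>\<omega>. (B r \<omega> - B t \<omega>) * (B s \<omega> - B t \<omega>))
      = expectation (\<lambda>\<omega>. B r \<omega> * B s \<omega> - B r \<omega> * B t \<omega> - B t \<omega> * B s \<omega> + B t \<omega> * B t \<omega>)"
      by (intro Bochner_Integration.integral_cong) (auto simp: algebra_simps)
    also have "\<dots> = expectation (\<lambda>\<omega>. B (r - t) \<omega> * B (s - t) \<omega>)"
      by (simp add: integrable_mult covariance_B abs_minus_commute field_simps)
    finally show ?thesis .
  qed
  have v: "expectation (\<lambda>\<omega>. (?Y \<omega>)\<^sup>2) / 2 = \<bar>t\<bar> powr \<alpha>"
    by (simp add: power_mult_distrib expectation_B_square)
  have m: "expectation (\<lambda>\<omega>. ?Y \<omega> * ?U s \<omega>) = \<bar>s\<bar> powr \<alpha> - \<bar>t\<bar> powr \<alpha> - \<bar>s - t\<bar> powr \<alpha>" for s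
  proof -
    have "expectation (\<lambda>\<omega>. ?Y \<omega> * ?U s \<omega>) = expectation (\<lambda>\<omega>. 2 * (B t \<omega> * B s \<omega> - B t \<omega> * B t \<omega>))"
      by (intro Bochner_Integration.integral_cong) (auto simp: algebra_simps)
    also have "\<dots> = \<bar>s\<bar> powr \<alpha> - \<bar>t\<bar> powr \<alpha> - \<bar>s - t\<bar> powr \<alpha>"
      unfolding integral_mult_right_zero by (simp add: integrable_mult covariance_B abs_minus_commute field_simps)
    finally show ?thesis .
  qed
  have "(\<integral>\<^sup>+\<omega>. ennreal (exp (?Y \<omega> - expectation (\<lambda>\<omega>. (?Y \<omega>)\<^sup>2) / 2)) *
      ?F (\<lambda>s. ?U s \<omega> - expectation (\<lambda>\<omega>. ?Y \<omega> * ?U s \<omega>)) \<partial>M) = (\<integral>\<^sup>+\<omega>. ?F (\<lambda>s. ?V s \<omega>) \<partial>M)"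
  proof (rule nn_integral_cameron_martin)
    show "expectation (\<lambda>\<omega>. ?U r \<omega> * ?U s \<omega>) = expectation (\<lambda>\<omega>. ?V r \<omega> * ?V s \<omega>)" for r s
    proof -
      have "expectation (\<lambda>\<omega>. ?U r \<omega> * ?U s \<omega>) = 2 * expectation (\<lambda>\<omega>. (B r \<omega> - B t \<omega>) * (B s \<omega> - B t \<omega>))"
        unfolding integral_mult_right_zero[symmetric]
        by (simp only: s2)
      also have "\<dots> = expectation (\<lambda>\<omega>. ?V r \<omega> * ?V s \<omega>)"
        unfolding cov_inc integral_mult_right_zero[symmetric]
        by (simp only: s2)
      finally show ?thesis .
    qed
  qed (auto intro!: scale_G diff_G)
  moreover have "?U s \<omega> - (\<bar>s\<bar> powr \<alpha> - \<bar>t\<bar> powr \<alpha> - \<bar>s - t\<bar> powr \<alpha>) - \<bar>s - t\<bar> powr \<alpha> = Z s \<omega> - Z t \<omega>" for s \<omega>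
    by (simp add: Z_def algebra_simps)
  ultimately show ?thesis
    unfolding v m by (simp add: Z_def)
qed

end

section \<open>Chaining and suprema\<close>

text \<open>A point of level \<open>n + 1\<close> either belongs to level \<open>n\<close> already
  or has its left neighbour there, so each level costs at most one increment.\<close>

lemma dyadic_chain:
  fixes f :: "real \<Rightarrow> real"
  assumes f0: "f 0 = 0" and \<Delta>: "\<And>m j. j < 2 ^ m \<Longrightarrow> \<bar>f (real (Suc j) / 2 ^ m) - f (real j / 2 ^ m)\<bar> \<le> \<Delta> m"
  shows "k \<le> 2 ^ n \<Longrightarrow> f (real k / 2 ^ n) \<le> (\<Sum>m\<le>n. \<Delta> m)"
proof (induction n arbitrary: k)
  case 0
  then have "k = 0 \<or> k = 1" by auto
  then show ?case using \<Delta>[of 0 0] f0 by auto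
next
  case (Suc n)
  have \<Delta>0: "0 \<le> \<Delta> m" for m using \<Delta>[of 0 m] by (simp add: order_trans[OF abs_ge_zero])
  show ?case
  proof (cases "even k")
    case True
    then obtain j where j: "k = 2 * j" by (elim evenE)
    then have "f (real k / 2 ^ Suc n) = f (real j / 2 ^ n)" by simp
    moreover have "j \<le> 2 ^ n" using Suc.prems j by simp
    ultimately show ?thesis using Suc.IH[of j] \<Delta>0[of "Suc n"] by simp
  next
    case False
    then obtain j where j: "k = Suc (2 * j)" by (elim oddE) simp
    then have jn: "2 * j < 2 ^ Suc n" "j \<le> 2 ^ n" using Suc.prems by simp_all
    have "f (real k / 2 ^ Suc n) \<le> f (real (2 * j) / 2 ^ Suc n) + \<Delta> (Suc n)"
      using \<Delta>[OF jn(1)] unfolding j by linarith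
    moreover have "f (real (2 * j) / 2 ^ Suc n) = f (real j / 2 ^ n)" by simp
    ultimately show ?thesis using Suc.IH[OF jn(2)] by simp
  qed
qed

text \<open>Jensen for \<open>exp\<close> with weights proportional to \<open>\<rho> ^ m\<close>: a
  product over levels becomes a sum, at the price of a factor of order \<open>\<rho> ^ (- m)\<close>
  in the exponent, which the decay of the increments will outweigh.\<close>

lemma exp_sum_le_geometric:
  fixes x :: "nat \<Rightarrow> real"
  assumes \<rho>: "0 < \<rho>" "\<rho> < 1" and x: "\<And>m. 0 \<le> x m"
  shows "exp (\<Sum>m\<le>n. x m) \<le> (\<Sum>m\<le>n. \<rho> ^ m * exp (x m * (1 / (1 - \<rho>)) / \<rho> ^ m))"
proof -
  define A where "A = (\<Sum>m\<le>n. \<rho> ^ m)"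
  have A1: "1 \<le> A" unfolding A_def using \<rho> member_le_sum[of 0 "{..n}" "\<lambda>m. \<rho> ^ m"] by simp
  have "summable (\<lambda>m. \<rho> ^ m)" using \<rho> by (intro summable_geometric) auto
  then have "A \<le> (\<Sum>m. \<rho> ^ m)" unfolding A_def using \<rho> by (intro sum_le_suminf) auto
  then have A2: "A \<le> 1 / (1 - \<rho>)" using \<rho> by (simp add: suminf_geometric)
  have "exp (\<Sum>m\<le>n. x m) = exp (\<Sum>m\<le>n. (\<rho> ^ m / A) *\<^sub>R (x m * A / \<rho> ^ m))"
    using \<rho> A1 by (intro arg_cong[where f=exp] sum.cong) auto
  also have "\<dots> \<le> (\<Sum>m\<le>n. \<rho> ^ m / A * exp (x m * A / \<rho> ^ m))"
  proof (rule convex_on_sum[OF _ _ exp_convex])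
    show "(\<Sum>m\<le>n. \<rho> ^ m / A) = 1"
      using A1 by (simp flip: sum_divide_distrib A_def)
  qed (use \<rho> A1 in auto)
  also have "\<dots> \<le> (\<Sum>m\<le>n. \<rho> ^ m * exp (x m * (1 / (1 - \<rho>)) / \<rho> ^ m))"
  proof (intro sum_mono mult_mono)
    fix m
    show "\<rho> ^ m / A \<le> \<rho> ^ m" using A1 \<rho> by (simp add: divide_le_eq mult_left_le)
    show "exp (x m * A / \<rho> ^ m) \<le> exp (x m * (1 / (1 - \<rho>)) / \<rho> ^ m)"
      using A2 \<rho> x[of m] by (simp only: exp_le_cancel_iff) (intro divide_right_mono mult_left_mono; simp)
  qed (use \<rho> in auto)
  finally show ?thesis .
qed

text \<open>For \<open>y > 2\<close> the factor \<open>(y / 2) ^ m\<close> is at least 1. The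
  division by \<open>2 ^ m\<close> later turns a sum over the \<open>2 ^ m\<close> increments of
  level \<open>m\<close> into an average; raising to the power \<open>Suc m\<close> multiplies the
  exponent only by \<open>m + 1\<close>.\<close>

lemma le_two_plus_power:
  assumes "0 \<le> (y :: real)"
  shows "y \<le> 2 + y ^ Suc m / 2 ^ m"
proof (cases "y \<le> 2")
  case False
  then have "(y / 2) ^ m \<ge> 1" by (intro one_le_power) simp
  then have "y * 1 \<le> y * (y / 2) ^ m" using assms by (intro mult_left_mono) auto
  then show ?thesis by (simp add: power_divide)
qed (use assms in \<open>simp add: add_increasing2\<close>)

text \<open>The bound is the same for all \<open>k\<close> and is a linear combination of
  exponentials of single increments, so its expectation can be computed term by term.\<close>

lemma exp_dyadic_le:
  fixes f :: "real \<Rightarrow> real"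
  assumes f0: "f 0 = 0" and \<rho>: "0 < \<rho>" "\<rho> < 1" and c: "0 \<le> c" and k: "k \<le> 2 ^ n"
  shows "exp (c * f (real k / 2 ^ n)) \<le> (\<Sum>m\<le>n. \<rho> ^ m * (2 +
     (\<Sum>j<2^m. exp (real (Suc m) * c / (1 - \<rho>) / \<rho> ^ m * \<bar>f (real (Suc j) / 2 ^ m) - f (real j / 2 ^ m)\<bar>)) / 2 ^ m))"
proof -
  define inc where "inc m j = \<bar>f (real (Suc j) / 2 ^ m) - f (real j / 2 ^ m)\<bar>" for m j
  \<comment> \<open>The largest increment of level \<open>m\<close>. It is attained at some
    \<open>j m\<close>, so its exponential is one of the terms of the sum that replaces it.\<close>
  define \<Delta> where "\<Delta> m = Max (inc m ` {..<2^m})" for m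
  have inc_le: "inc m j \<le> \<Delta> m" if "j < 2 ^ m" for m j
    unfolding \<Delta>_def using that by (intro Max_ge) auto
  have "\<Delta> m \<in> inc m ` {..<2^m}" for m
    unfolding \<Delta>_def by (intro Max_in) (auto simp: lessThan_empty_iff)
  then have "\<forall>m. \<exists>j<2^m. \<Delta> m = inc m j" by auto
  then obtain j where j: "\<And>m. j m < 2 ^ m" "\<And>m. \<Delta> m = inc m (j m)" by metis
  have \<Delta>0: "0 \<le> \<Delta> m" for m using j(2)[of m] by (simp add: inc_def)
  have "f (real k / 2 ^ n) \<le> (\<Sum>m\<le>n. \<Delta> m)"
    by (rule dyadic_chain[where f=f, OF f0]) (use inc_le k in \<open>simp_all add: inc_def\<close>)
  then have "exp (c * f (real k / 2 ^ n)) \<le> exp (\<Sum>m\<le>n. c * \<Delta> m)"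
    using c by (simp add: mult_left_mono flip: sum_distrib_left)
  also have "\<dots> \<le> (\<Sum>m\<le>n. \<rho> ^ m * exp (c * \<Delta> m * (1 / (1 - \<rho>)) / \<rho> ^ m))"
    using c \<Delta>0 by (intro exp_sum_le_geometric[OF \<rho>]) simp
  also have "\<dots> \<le> (\<Sum>m\<le>n. \<rho> ^ m * (2 +
     (\<Sum>j<2^m. exp (real (Suc m) * c / (1 - \<rho>) / \<rho> ^ m * inc m j)) / 2 ^ m))"
  proof (intro sum_mono mult_left_mono)
    fix m
    let ?y = "exp (c * \<Delta> m * (1 / (1 - \<rho>)) / \<rho> ^ m)"
    have "?y \<le> 2 + ?y ^ Suc m / 2 ^ m" by (rule le_two_plus_power) simp
    also have "?y ^ Suc m = exp (real (Suc m) * c / (1 - \<rho>) / \<rho> ^ m * inc m (j m))"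
      unfolding exp_of_nat_mult[symmetric] j(2) by (simp add: field_simps)
    also have "\<dots> \<le> (\<Sum>j<2^m. exp (real (Suc m) * c / (1 - \<rho>) / \<rho> ^ m * inc m j))"
      using j(1) by (intro member_le_sum) auto
    finally show "?y \<le> 2 + (\<Sum>j<2^m. exp (real (Suc m) * c / (1 - \<rho>) / \<rho> ^ m * inc m j)) / 2 ^ m"
      by (simp add: divide_right_mono)
  qed (use \<rho> in auto)
  finally show ?thesis unfolding inc_def .
qed

text \<open>A finite bound on \<open>D\<close> passes to the closure by continuity, and an infinite
  one bounds everything.\<close>

lemma SUP_ennreal_eq_dense:
  fixes g :: "real \<Rightarrow> real"
  assumes g: "continuous_on UNIV g" and D: "D \<subseteq> S" "S \<subseteq> closure D"
  shows "(SUP t\<in>S. ennreal (g t)) = (SUP t\<in>D. ennreal (g t))"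
proof (rule antisym)
  show "(SUP t\<in>D. ennreal (g t)) \<le> (SUP t\<in>S. ennreal (g t))"
    using D by (intro SUP_subset_mono) auto
  show "(SUP t\<in>S. ennreal (g t)) \<le> (SUP t\<in>D. ennreal (g t))"
  proof (cases "(SUP t\<in>D. ennreal (g t))")
    case (real r)
    have "g t \<le> r" if "t \<in> D" for t
    proof -
      have "ennreal (g t) \<le> ennreal r" using that unfolding real(2)[symmetric] by (rule SUP_upper)
      then show ?thesis using real(1) by (simp add: ennreal_le_iff)
    qed
    then have "g t \<le> r" if "t \<in> S" for t
      using continuous_le_on_closure[of D g t r] continuous_on_subset[OF g] D that by auto
    then show ?thesis unfolding real(2) by (intro SUP_least) (simp add: real(1) ennreal_leI)
  next
    case top
    then show ?thesis by (simp only: top_greatest)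
  qed
qed

section \<open>Suprema of \<open>exp (Z t)\<close> over sets of times and their expectations\<close>

context standard_fbm
begin

lemma continuous_on_Z: "0 < \<alpha> \<Longrightarrow> \<omega> \<in> space M \<Longrightarrow> continuous_on UNIV (\<lambda>t. Z t \<omega>)"
  unfolding Z_def using continuous_paths
  by (intro continuous_intros continuous_on_powr') auto

text \<open>The factor 2 pays for the absolute value: \<open>exp (c * \<bar>d\<bar>)\<close> is at
  most the sum of the exponentials for both signs.\<close>

lemma nn_integral_exp_increment:
  "(\<integral>\<^sup>+\<omega>. ennreal (exp (c * \<bar>B s \<omega> - B t \<omega>\<bar>)) \<partial>M) \<le> ennreal (2 * exp (c\<^sup>2 * \<bar>s - t\<bar> powr \<alpha> / 2))"
proof -
  have E: "(\<integral>\<^sup>+\<omega>. ennreal (exp (c * (B s \<omega> - B t \<omega>))) \<partial>M) = ennreal (exp (c\<^sup>2 * \<bar>s - t\<bar> powr \<alpha> / 2))" for c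
  proof -
    have G: "(\<lambda>\<omega>. c * (B s \<omega> - B t \<omega>)) \<in> span_B"
      by (intro scale_G diff_G) simp_all
    show ?thesis
      using integrable_exp[OF G] expectation_exp[OF G]
      by (subst nn_integral_eq_integral) (auto simp: power_mult_distrib expectation_increment_square)
  qed
  have "(\<integral>\<^sup>+\<omega>. ennreal (exp (c * \<bar>B s \<omega> - B t \<omega>\<bar>)) \<partial>M) \<le>
      (\<integral>\<^sup>+\<omega>. ennreal (exp (c * (B s \<omega> - B t \<omega>))) + ennreal (exp ((-c) * (B s \<omega> - B t \<omega>))) \<partial>M)"
  proof (rule nn_integral_mono)
    fix \<omega>
    have "exp (c * \<bar>d\<bar>) \<le> exp (c * d) + exp ((-c) * d)" for d :: real
      by (cases "0 \<le> d") (simp_all add: add_increasing add_increasing2)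
    then show "ennreal (exp (c * \<bar>B s \<omega> - B t \<omega>\<bar>))
      \<le> ennreal (exp (c * (B s \<omega> - B t \<omega>))) + ennreal (exp ((-c) * (B s \<omega> - B t \<omega>)))"
      by (simp add: ennreal_leI flip: ennreal_plus)
  qed
  also have "\<dots> = ennreal (2 * exp (c\<^sup>2 * \<bar>s - t\<bar> powr \<alpha> / 2))"
    by (subst nn_integral_add) (auto simp: E E[of "-c", simplified] simp flip: ennreal_plus)
  finally show ?thesis .
qed

text \<open>In \<open>ennreal\<close> the supremum makes sense for every set of times: unbounded
  ones need no case split, and the empty set gives 0.\<close>

definition esup :: "real set \<Rightarrow> 'a \<Rightarrow> ennreal" where
  "esup S \<omega> = (SUP t\<in>S. ennreal (exp (Z t \<omega>)))"

text \<open>The countable set is chosen before the path, which is what measurability of the supremum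
  needs.\<close>

lemma esup_dense:
  assumes "0 < \<alpha>"
  obtains D where "countable D" "D \<subseteq> S" "\<And>\<omega>. \<omega> \<in> space M \<Longrightarrow> esup S \<omega> = esup D \<omega>"
proof -
  obtain D where D: "countable D" "D \<subseteq> S" "S \<subseteq> closure D" using separable by blast
  have "esup S \<omega> = esup D \<omega>" if "\<omega> \<in> space M" for \<omega>
    unfolding esup_def using D continuous_on_Z[OF assms that]
    by (intro SUP_ennreal_eq_dense continuous_intros) auto
  with D that show ?thesis by blast
qed

lemma measurable_esup [measurable]:
  assumes "0 < \<alpha>"
  shows "esup S \<in> borel_measurable M"
proof -
  obtain D where D: "countable D" "\<And>\<omega>. \<omega> \<in> space M \<Longrightarrow> esup S \<omega> = esup D \<omega>"
    using esup_dense[OF assms] by metis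
  have "esup D \<in> borel_measurable M"
    unfolding esup_def[abs_def] using D(1) by (intro borel_measurable_SUP) auto
  then show ?thesis using D(2) measurable_cong[of M "esup S" "esup D"] by auto
qed

definition Esup :: "real set \<Rightarrow> ennreal" where
  "Esup S = (\<integral>\<^sup>+\<omega>. esup S \<omega> \<partial>M)"

lemma Esup_mono: "S \<subseteq> T \<Longrightarrow> Esup S \<le> Esup T"
  unfolding Esup_def esup_def by (intro nn_integral_mono SUP_subset_mono) auto

lemma Esup_Un_le:
  assumes "0 < \<alpha>"
  shows "Esup (S \<union> T) \<le> Esup S + Esup T"
proof -
  note [measurable] = measurable_esup[OF assms]
  have "Esup (S \<union> T) \<le> (\<integral>\<^sup>+\<omega>. esup S \<omega> + esup T \<omega> \<partial>M)"
    unfolding Esup_def by (intro nn_integral_mono) (simp add: esup_def SUP_union add_increasing add_increasing2)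
  then show ?thesis by (simp add: nn_integral_add Esup_def)
qed

text \<open>Factor \<open>exp (Z s)\<close> as \<open>exp (Z t) * exp (Z s - Z t)\<close>; the tilt
  by \<open>exp (Z t)\<close> then replaces the second factor by
  \<open>exp (Z (s - t))\<close>.\<close>

lemma Esup_shift:
  assumes "0 < \<alpha>"
  shows "Esup ((+) t ` S) = Esup S"
proof -
  obtain D where D: "countable D" "\<And>\<omega>. \<omega> \<in> space M \<Longrightarrow> esup ((+) t ` S) \<omega> = esup D \<omega>" "D \<subseteq> (+) t ` S"
    using esup_dense[OF assms] by metis
  obtain D' where D': "countable D'" "\<And>\<omega>. \<omega> \<in> space M \<Longrightarrow> esup S \<omega> = esup D' \<omega>" "D' \<subseteq> S"
    using esup_dense[OF assms] by metis
  \<comment> \<open>One countable set must serve both sides: it exhausts the supremum over the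
    shifted set and, moved back by \<open>t\<close>, the one over \<open>S\<close>. Countability
    makes \<open>?F\<close> measurable on path space.\<close>
  define C where "C = D \<union> (+) t ` D'"
  have C: "countable C" unfolding C_def using D D' by auto
  define C' where "C' = (\<lambda>s. s - t) ` C"
  have sub: "esup A \<omega> \<le> esup A' \<omega>" if "A \<subseteq> A'" for A A' \<omega>
    unfolding esup_def using that by (intro SUP_subset_mono) auto
  have 1: "esup ((+) t ` S) \<omega> = esup C \<omega>" if "\<omega> \<in> space M" for \<omega>
    using D(2)[OF that] sub[of D C \<omega>] sub[of C "(+) t ` S" \<omega>] D(3) D'(3) by (auto simp: C_def intro!: antisym)
  have C'S: "C' \<subseteq> S" "D' \<subseteq> C'"
    unfolding C'_def C_def using D(3) D'(3) by (auto simp: image_Un image_image)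
  have 2: "esup S \<omega> = esup C' \<omega>" if "\<omega> \<in> space M" for \<omega>
    using D'(2)[OF that] sub[OF C'S(1), of \<omega>] sub[OF C'S(2), of \<omega>] by (auto intro!: antisym)
  let ?F = "\<lambda>x :: real \<Rightarrow> real. SUP s\<in>C. ennreal (exp (x s))"
  have [measurable]: "?F \<in> borel_measurable (\<Pi>\<^sub>M t\<in>UNIV. borel)"
    by (intro borel_measurable_SUP C) auto
  have "Esup ((+) t ` S) = (\<integral>\<^sup>+\<omega>. esup C \<omega> \<partial>M)"
    unfolding Esup_def using 1 by (intro nn_integral_cong) auto
  also have "\<dots> = (\<integral>\<^sup>+\<omega>. ennreal (exp (Z t \<omega>)) * ?F (\<lambda>s. Z s \<omega> - Z t \<omega>) \<partial>M)"
    unfolding esup_def by (simp add: SUP_mult_left_ennreal flip: ennreal_mult exp_add)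
  also have "\<dots> = (\<integral>\<^sup>+\<omega>. ?F (\<lambda>s. Z (s - t) \<omega>) \<partial>M)"
    by (rule nn_integral_shift) measurable
  also have "\<dots> = (\<integral>\<^sup>+\<omega>. esup C' \<omega> \<partial>M)"
    unfolding esup_def C'_def by (simp add: image_image)
  also have "\<dots> = Esup S"
    unfolding Esup_def using 2 by (intro nn_integral_cong) auto
  finally show ?thesis .
qed

end

section \<open>Finiteness, subadditivity and discretization\<close>

text \<open>Each of the first \<open>m + 1\<close> terms of the geometric series is at least
  \<open>\<rho> ^ m\<close>. This absorbs the factor \<open>m + 1\<close> that
  \<open>le_two_plus_power\<close> puts into the exponent.\<close>

lemma Suc_mult_power_le:
  assumes \<rho>: "0 < \<rho>" "\<rho> < (1 :: real)"
  shows "real (Suc m) * \<rho> ^ m \<le> 1 / (1 - \<rho>)"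
proof -
  have "real (Suc m) * \<rho> ^ m = (\<Sum>k\<le>m. \<rho> ^ m)" by simp
  also have "\<dots> \<le> (\<Sum>k\<le>m. \<rho> ^ k)"
    using \<rho> by (intro sum_mono power_decreasing) auto
  also have "\<dots> \<le> (\<Sum>k. \<rho> ^ k)"
    using \<rho> by (intro sum_le_suminf summable_geometric) auto
  also have "\<dots> = 1 / (1 - \<rho>)" using \<rho> by (simp add: suminf_geometric)
  finally show ?thesis .
qed

text \<open>Fekete's lemma for a real argument, the limit being the infimum of the ratios;
  monotonicity allows \<open>T\<close> to be rounded up to a multiple of \<open>S\<close>.\<close>

lemma subadditive_over_id_tendsto:
  fixes h :: "real \<Rightarrow> real"
  assumes nonneg: "\<And>T. 0 \<le> h T" and mono: "\<And>S T. S \<le> T \<Longrightarrow> h S \<le> h T"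
    and sub: "\<And>S T. 0 \<le> S \<Longrightarrow> 0 \<le> T \<Longrightarrow> h (S + T) \<le> h S + h T"
  shows "\<exists>L. ((\<lambda>T. h T / T) \<longlongrightarrow> L) at_top"
proof -
  define L where "L = (INF T\<in>{0<..}. h T / T)"
  have bdd: "bdd_below ((\<lambda>T. h T / T) ` {0<..})"
    using nonneg by (intro bdd_belowI[of _ 0]) auto
  have nm: "h (real (Suc n) * S) \<le> real (Suc n) * h S" if "0 < S" for n S
  proof (induction n)
    case (Suc n)
    have "h (real (Suc (Suc n)) * S) = h (real (Suc n) * S + S)" by (simp add: algebra_simps)
    also have "\<dots> \<le> h (real (Suc n) * S) + h S" using that by (intro sub) auto
    finally show ?case using Suc by (simp add: algebra_simps)
  qed simp
  have "((\<lambda>T. h T / T) \<longlongrightarrow> L) at_top"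
  proof (rule order_tendstoI)
    fix l assume "l < L"
    have "L \<le> h T / T" if "0 < T" for T
      unfolding L_def using that by (intro cINF_lower bdd) auto
    then show "eventually (\<lambda>T. l < h T / T) at_top"
      using \<open>l < L\<close> by (intro eventually_mono[OF eventually_gt_at_top[of 0]]) (rule less_le_trans)
  next
    fix u assume "L < u"
    then obtain S where S: "0 < S" "h S / S < u"
      unfolding L_def by (subst (asm) cINF_less_iff) (auto intro: bdd)
    have "((\<lambda>T. h S / S + h S / T) \<longlongrightarrow> h S / S + 0) at_top"
      by (intro tendsto_intros tendsto_divide_0[OF tendsto_const] filterlim_at_top_imp_at_infinity filterlim_ident)
    then have "eventually (\<lambda>T. h S / S + h S / T < u) at_top"
      using S(2) by (intro order_tendstoD) auto
    then show "eventually (\<lambda>T. h T / T < u) at_top"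
      using eventually_gt_at_top[of 0]
    proof eventually_elim
      case (elim T)
      define n where "n = nat \<lfloor>T / S\<rfloor>"
      have TS: "0 \<le> T / S" using elim S by simp
      have n1: "real n \<le> T / S" and n2: "T / S \<le> real (Suc n)"
        unfolding n_def using TS by linarith+
      have "h T \<le> h (real (Suc n) * S)"
        using n2 S(1) by (intro mono) (simp add: pos_divide_le_eq)
      also have "\<dots> \<le> real (Suc n) * h S" by (rule nm[OF S(1)])
      also have "\<dots> \<le> (T / S + 1) * h S" using n1 nonneg by (intro mult_right_mono) auto
      finally have "h T / T \<le> (T / S + 1) * h S / T" using elim by (intro divide_right_mono) auto
      also have "\<dots> = h S / S + h S / T" using elim S by (simp add: field_simps)
      finally show ?case using elim by simp
    qed
  qed
  then show ?thesis by blast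
qed

lemma interval_split: "0 \<le> S \<Longrightarrow> 0 \<le> T \<Longrightarrow> {0..S + T} = {0..S} \<union> (+) S ` {0..T::real}"
  by auto

context standard_fbm
begin

text \<open>Chaining over the dyadic points of the unit interval: the levels contribute a geometric
  series in expectation.\<close>

lemma Esup_unit_finite:
  assumes \<alpha>: "0 < \<alpha>"
  shows "Esup {0..1} < \<top>"
proof -
  \<comment> \<open>With this choice an increment of level \<open>m\<close> has variance
    \<open>\<rho> ^ (4 * m)\<close>. Half of it cancels the \<open>\<rho> ^ (- 2 * m)\<close> in the
    square of \<open>l m\<close>, the other half controls the factor \<open>(m + 1)\<close>
    squared.\<close>
  define \<rho> :: real where "\<rho> = 2 powr (- \<alpha> / 4)"
  have \<rho>: "0 < \<rho>" "\<rho> < 1" using \<alpha> by (auto simp: \<rho>_def powr_less_one)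
  define l where "l m = real (Suc m) * sqrt 2 / (1 - \<rho>) / \<rho> ^ m" for m
  define inc where "inc m j \<omega> = \<bar>B (real (Suc j) / 2 ^ m) \<omega> - B (real j / 2 ^ m) \<omega>\<bar>" for m j \<omega>
  have [measurable]: "inc m j \<in> borel_measurable M" for m j unfolding inc_def[abs_def] by measurable
  define w where "w m \<omega> = \<rho> ^ m * (2 + (\<Sum>j<2^m. exp (l m * inc m j \<omega>)) / 2 ^ m)" for m \<omega>
  have w0: "0 \<le> w m \<omega>" for m \<omega> unfolding w_def using \<rho> by (simp add: sum_nonneg)
  have [measurable]: "w m \<in> borel_measurable M" for m unfolding w_def[abs_def] by measurable
  define K where "K = 2 + 2 * exp ((sqrt 2 / (1 - \<rho>))\<^sup>2 * (1 / (1 - \<rho>))\<^sup>2 / 2)"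
  have expl: "(l m)\<^sup>2 * \<bar>real (Suc j) / 2 ^ m - real j / 2 ^ m\<bar> powr \<alpha> / 2
      \<le> (sqrt 2 / (1 - \<rho>))\<^sup>2 * (1 / (1 - \<rho>))\<^sup>2 / 2" for m j
  proof -
    have "\<bar>real (Suc j) / 2 ^ m - real j / 2 ^ m\<bar> = 2 powr (- real m)"
      by (simp add: powr_minus powr_realpow field_simps flip: diff_divide_distrib)
    then have "\<bar>real (Suc j) / 2 ^ m - real j / 2 ^ m\<bar> powr \<alpha> = \<rho> powr (4 * real m)"
      by (simp add: powr_powr \<rho>_def mult_ac)
    also have "\<dots> = \<rho> ^ (4 * m)"
      using powr_realpow[OF \<rho>(1), of "4 * m"] by simp
    also have "\<dots> = (\<rho> ^ m)\<^sup>2 * (\<rho> ^ m)\<^sup>2"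
      by (simp add: power_mult[symmetric] power_add[symmetric])
    finally have "(l m)\<^sup>2 * \<bar>real (Suc j) / 2 ^ m - real j / 2 ^ m\<bar> powr \<alpha>
       = (sqrt 2 / (1 - \<rho>))\<^sup>2 * (real (Suc m) * \<rho> ^ m)\<^sup>2"
      using \<rho> by (simp only: l_def power_mult_distrib power_divide) (simp add: field_simps)
    also have "\<dots> \<le> (sqrt 2 / (1 - \<rho>))\<^sup>2 * (1 / (1 - \<rho>))\<^sup>2"
      using \<rho> Suc_mult_power_le[OF \<rho>, of m] by (intro mult_left_mono power_mono) auto
    finally show ?thesis by (rule divide_right_mono) simp
  qed
  have iw: "(\<integral>\<^sup>+\<omega>. ennreal (w m \<omega>) \<partial>M) \<le> ennreal (\<rho> ^ m * K)" for m
  proof -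
    have "(\<integral>\<^sup>+\<omega>. ennreal (w m \<omega>) \<partial>M) = ennreal (\<rho> ^ m) * (2 + ennreal (1 / 2 ^ m) * (\<Sum>j<2^m. \<integral>\<^sup>+\<omega>. ennreal (exp (l m * inc m j \<omega>)) \<partial>M))"
    proof -
      have "ennreal (w m \<omega>) = ennreal (\<rho> ^ m) * (2 + ennreal (1 / 2 ^ m) * (\<Sum>j<2^m. ennreal (exp (l m * inc m j \<omega>))))" for \<omega>
        using \<rho> by (simp add: w_def ennreal_mult ennreal_plus sum_nonneg sum_ennreal divide_inverse mult.commute)
      then show ?thesis
        by (simp add: nn_integral_cmult nn_integral_add nn_integral_sum emeasure_space_1 del: sum_ennreal)
    qed
    also have "\<dots> \<le> ennreal (\<rho> ^ m) * (2 + ennreal (1 / 2 ^ m) * (\<Sum>j<(2::nat)^m. ennreal (K - 2)))"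
    proof (intro mult_left_mono add_left_mono sum_mono)
      fix j :: nat
      have "(\<integral>\<^sup>+\<omega>. ennreal (exp (l m * inc m j \<omega>)) \<partial>M)
        \<le> ennreal (2 * exp ((l m)\<^sup>2 * \<bar>real (Suc j) / 2 ^ m - real j / 2 ^ m\<bar> powr \<alpha> / 2))"
        unfolding inc_def by (rule nn_integral_exp_increment)
      also have "\<dots> \<le> ennreal (K - 2)"
        using expl[of m j] by (intro ennreal_leI) (simp add: K_def)
      finally show "(\<integral>\<^sup>+\<omega>. ennreal (exp (l m * inc m j \<omega>)) \<partial>M) \<le> ennreal (K - 2)" .
    qed auto
    also have "(\<Sum>j<(2::nat)^m. ennreal (K - 2)) = ennreal (2 ^ m * (K - 2))"
      by (simp add: ennreal_mult K_def flip: ennreal_power ennreal_numeral)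
    also have "ennreal (1 / 2 ^ m) * ennreal (2 ^ m * (K - 2)) = ennreal (K - 2)"
      by (simp add: K_def flip: ennreal_mult)
    also have "ennreal (\<rho> ^ m) * (2 + ennreal (K - 2)) = ennreal (\<rho> ^ m * K)"
    proof -
      have "2 + ennreal (K - 2) = ennreal (2 + (K - 2))" by (subst ennreal_plus) (auto simp: K_def)
      then show ?thesis using \<rho> by (simp add: ennreal_mult K_def)
    qed
    finally show ?thesis .
  qed
  have le: "esup {0..1} \<omega> \<le> (\<Sum>m. ennreal (w m \<omega>))" if \<omega>: "\<omega> \<in> space M" for \<omega>
  proof -
    let ?D = "{0..1::real} \<inter> (\<Union>k m. {of_nat m / 2 ^ k})"
    have "closure ?D = closure {0..1}"
      by (rule closure_dyadic_rationals_in_convex_set_pos_1) auto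
    then have "esup {0..1} \<omega> = (SUP t\<in>?D. ennreal (exp (Z t \<omega>)))"
      unfolding esup_def using continuous_on_Z[OF \<alpha> \<omega>]
      by (intro SUP_ennreal_eq_dense continuous_intros) auto
    also have "\<dots> \<le> (\<Sum>m. ennreal (w m \<omega>))"
    proof (rule SUP_least)
      fix t assume "t \<in> ?D"
      then obtain k n where t: "t = real k / 2 ^ n" "t \<le> 1" by auto
      then have "real k \<le> real (2 ^ n)" by simp
      then have k: "k \<le> 2 ^ n" by (simp only: of_nat_le_iff)
      have "exp (Z t \<omega>) \<le> exp (sqrt 2 * B (real k / 2 ^ n) \<omega>)"
        unfolding Z_def t(1) by simp
      also have "\<dots> \<le> (\<Sum>m\<le>n. w m \<omega>)"
        using exp_dyadic_le[where f="\<lambda>t. B t \<omega>", OF starts_at_0[OF \<omega>] \<rho> _ k, of "sqrt 2"] unfolding w_def l_def inc_def by simp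
      finally have "ennreal (exp (Z t \<omega>)) \<le> ennreal (\<Sum>m\<le>n. w m \<omega>)" by (rule ennreal_leI)
      also have "\<dots> = (\<Sum>m\<le>n. ennreal (w m \<omega>))" using w0 by (simp add: sum_ennreal)
      also have "\<dots> \<le> (\<Sum>m. ennreal (w m \<omega>))" by (intro sum_le_suminf) auto
      finally show "ennreal (exp (Z t \<omega>)) \<le> (\<Sum>m. ennreal (w m \<omega>))" .
    qed
    finally show ?thesis .
  qed
  have "Esup {0..1} \<le> (\<integral>\<^sup>+\<omega>. (\<Sum>m. ennreal (w m \<omega>)) \<partial>M)"
    unfolding Esup_def by (intro nn_integral_mono le)
  also have "\<dots> = (\<Sum>m. \<integral>\<^sup>+\<omega>. ennreal (w m \<omega>) \<partial>M)"
    by (rule nn_integral_suminf) measurable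
  also have "\<dots> \<le> (\<Sum>m. ennreal (\<rho> ^ m * K))"
    by (intro suminf_le iw) auto
  also have "\<dots> < \<top>"
    using \<rho> by (subst less_top[symmetric], intro ennreal_suminf_neq_top summable_mult2 summable_geometric)
      (auto simp: K_def)
  finally show ?thesis .
qed

lemma Esup_interval_finite:
  assumes \<alpha>: "0 < \<alpha>"
  shows "Esup {0..T} < \<top>"
proof -
  have *: "Esup {0..real n} < \<top>" for n
  proof (induction n)
    case 0
    show ?case using Esup_mono[of "{0..real 0}" "{0..1}"] Esup_unit_finite[OF \<alpha>] by (auto intro: le_less_trans)
  next
    case (Suc n)
    have "{0..real (Suc n)} = {0..real n} \<union> (+) (real n) ` {0..1}"
      using interval_split[of "real n" 1] by (simp add: add.commute)
    then have "Esup {0..real (Suc n)} \<le> Esup {0..real n} + Esup {0..1}"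
      using Esup_Un_le[OF \<alpha>, of "{0..real n}" "(+) (real n) ` {0..1}"] Esup_shift[OF \<alpha>, of "real n" "{0..1}"]
      by (simp only:)
    then show ?case using Suc Esup_unit_finite[OF \<alpha>] by (auto intro: le_less_trans simp: ennreal_add_less_top)
  qed
  obtain n where "T \<le> real n" using real_arch_simple by blast
  then have "Esup {0..T} \<le> Esup {0..real n}" by (intro Esup_mono) auto
  then show ?thesis using * by (rule le_less_trans)
qed

lemma esup_compact:
  assumes "0 < \<alpha>" "\<omega> \<in> space M" "compact S" "S \<noteq> {}"
  obtains t where "t \<in> S" "\<And>s. s \<in> S \<Longrightarrow> Z s \<omega> \<le> Z t \<omega>" "esup S \<omega> = ennreal (exp (Z t \<omega>))"
    "(SUP s\<in>S. exp (Z s \<omega>)) = exp (Z t \<omega>)"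
proof -
  obtain t where t: "t \<in> S" "\<And>s. s \<in> S \<Longrightarrow> Z s \<omega> \<le> Z t \<omega>"
    using continuous_attains_sup[of S "\<lambda>t. Z t \<omega>"] assms continuous_on_subset[OF continuous_on_Z[of \<omega>]] by auto
  moreover have "esup S \<omega> = ennreal (exp (Z t \<omega>))"
    unfolding esup_def using t by (intro antisym SUP_least SUP_upper) (auto intro!: ennreal_leI)
  moreover have "(SUP s\<in>S. exp (Z s \<omega>)) = exp (Z t \<omega>)"
    using t by (intro cSup_eq_maximum) auto
  ultimately show ?thesis by (rule that)
qed

text \<open>Links the real suprema and Bochner integrals of \<open>pickands_constant\<close> to
  \<open>Esup\<close>; on a compact set the supremum is attained, so it is finite on every
  path.\<close>

lemma expectation_SUP_exp_Z:
  assumes \<alpha>: "0 < \<alpha>" and S: "compact S" "S \<noteq> {}"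
  shows "(\<lambda>\<omega>. SUP t\<in>S. exp (Z t \<omega>)) \<in> borel_measurable M"
    and "expectation (\<lambda>\<omega>. SUP t\<in>S. exp (Z t \<omega>)) = enn2real (Esup S)"
proof -
  note [measurable] = measurable_esup[OF \<alpha>]
  have eq: "(SUP t\<in>S. exp (Z t \<omega>)) = enn2real (esup S \<omega>)" if "\<omega> \<in> space M" for \<omega>
    using esup_compact[OF \<alpha> that S] by (metis enn2real_ennreal exp_ge_zero)
  have eq2: "ennreal (SUP t\<in>S. exp (Z t \<omega>)) = esup S \<omega>" "0 \<le> (SUP t\<in>S. exp (Z t \<omega>))" if "\<omega> \<in> space M" for \<omega>
    using esup_compact[OF \<alpha> that S] by (metis exp_ge_zero)+
  show m: "(\<lambda>\<omega>. SUP t\<in>S. exp (Z t \<omega>)) \<in> borel_measurable M"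
    by (subst measurable_cong[OF eq]) measurable
  show "expectation (\<lambda>\<omega>. SUP t\<in>S. exp (Z t \<omega>)) = enn2real (Esup S)"
    unfolding Esup_def using eq2 by (subst integral_eq_nn_integral[OF m]) (auto intro!: arg_cong[where f=enn2real] nn_integral_cong)
qed

section \<open>The continuous constant and the discretization error\<close>

definition hsup :: "real \<Rightarrow> real" where
  "hsup T = enn2real (Esup {0..T})"

lemma hsup_nonneg [simp]: "0 \<le> hsup T"
  by (simp add: hsup_def)

lemma Esup_eq_hsup: "0 < \<alpha> \<Longrightarrow> Esup {0..T} = ennreal (hsup T)"
  unfolding hsup_def using Esup_interval_finite[of T] by simp

lemma hsup_eq_expectation:
  assumes "0 < \<alpha>" "0 \<le> T"
  shows "expectation (\<lambda>\<omega>. SUP t\<in>{0..T}. exp (sqrt 2 * B t \<omega> - \<bar>t\<bar> powr \<alpha>)) = hsup T"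
  using expectation_SUP_exp_Z(2)[OF assms(1), of "{0..T}"] assms(2) by (simp add: hsup_def Z_def)

text \<open>The constant is defined by \<open>Lim\<close>, so its value can be used only after
  convergence is known; shift invariance makes \<open>hsup\<close> subadditive.\<close>

lemma hsup_tendsto_pickands:
  assumes \<alpha>: "0 < \<alpha>"
  shows "((\<lambda>T. hsup T / T) \<longlongrightarrow> pickands_constant M \<alpha> B) at_top"
proof -
  have "\<exists>L. ((\<lambda>T. hsup T / T) \<longlongrightarrow> L) at_top"
  proof (rule subadditive_over_id_tendsto)
    show "0 \<le> hsup T" for T by simp
    show "hsup S \<le> hsup T" if "S \<le> T" for S T
      unfolding hsup_def using that Esup_interval_finite[OF \<alpha>]
      by (intro enn2real_mono Esup_mono) auto
    show "hsup (S + T) \<le> hsup S + hsup T" if "0 \<le> S" "0 \<le> T" for S T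
    proof -
      have "Esup {0..S + T} \<le> Esup {0..S} + Esup {0..T}"
        unfolding interval_split[OF that] using Esup_Un_le[OF \<alpha>] Esup_shift[OF \<alpha>] by metis
      then show ?thesis
        by (simp add: Esup_eq_hsup[OF \<alpha>] flip: ennreal_plus)
    qed
  qed
  then obtain L where L: "((\<lambda>T. hsup T / T) \<longlongrightarrow> L) at_top" by blast
  have eq: "hsup T / T = 1 / T * (LINT \<omega>|M. (SUP t\<in>{0..T}. exp (sqrt 2 * B t \<omega> - \<bar>t\<bar> powr \<alpha>)))"
    if "0 \<le> T" for T
    unfolding hsup_eq_expectation[OF \<alpha> that] by simp
  have "((\<lambda>T. 1 / T * (LINT \<omega>|M. (SUP t\<in>{0..T}. exp (sqrt 2 * B t \<omega> - \<bar>t\<bar> powr \<alpha>)))) \<longlongrightarrow> L) at_top"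
    by (rule Lim_transform_eventually[OF L])
      (intro eventually_mono[OF eventually_ge_at_top[of 0]] eq)
  then have "pickands_constant M \<alpha> B = L"
    unfolding pickands_constant_def by (intro tendsto_Lim) auto
  with L show ?thesis by simp
qed

text \<open>Up to rearrangement, the error of replacing \<open>A \<union> C\<close> by
  \<open>a \<union> b\<close> is at most the sum of the errors on the two pieces. Pointwise this
  holds because a maximum is the sum minus the minimum, and the minimum is monotone. The form
  without subtraction suits \<open>ennreal\<close>.\<close>

lemma Esup_exchange:
  assumes \<alpha>: "0 < \<alpha>" and "a \<subseteq> A" "b \<subseteq> C"
  shows "Esup (A \<union> C) + Esup a + Esup b \<le> Esup (a \<union> b) + Esup A + Esup C"
proof -
  note [measurable] = measurable_esup[OF \<alpha>]
  have un: "esup (S \<union> T) \<omega> = max (esup S \<omega>) (esup T \<omega>)" for S T \<omega>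
    by (simp add: esup_def SUP_union sup_max)
  have "Esup (A \<union> C) + Esup a + Esup b = (\<integral>\<^sup>+\<omega>. esup (A \<union> C) \<omega> + esup a \<omega> + esup b \<omega> \<partial>M)"
    by (simp add: Esup_def nn_integral_add)
  also have "\<dots> \<le> (\<integral>\<^sup>+\<omega>. esup (a \<union> b) \<omega> + esup A \<omega> + esup C \<omega> \<partial>M)"
  proof (rule nn_integral_mono)
    fix \<omega>
    have max_plus_min: "max u v + min u v = u + v" for u v :: ennreal
      by (simp add: max_def min_def add.commute)
    have *: "max p q + x + y \<le> max x y + p + q" if "x \<le> p" "y \<le> q" for p q x y :: ennreal
    proof -
      have "min x y \<le> min p q" using that by (rule min.mono)
      then have "max p q + (max x y + min x y) \<le> max x y + (max p q + min p q)"
        using add_left_mono[of "min x y" "min p q" "max p q + max x y"] by (simp only: ac_simps)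
      then show ?thesis
        by (simp only: max_plus_min add.assoc)
    qed
    have "esup a \<omega> \<le> esup A \<omega>" "esup b \<omega> \<le> esup C \<omega>"
      unfolding esup_def using assms by (auto intro!: SUP_subset_mono)
    then show "esup (A \<union> C) \<omega> + esup a \<omega> + esup b \<omega> \<le> esup (a \<union> b) \<omega> + esup A \<omega> + esup C \<omega>"
      unfolding un by (rule *)
  qed
  also have "\<dots> = Esup (a \<union> b) + Esup A + Esup C"
    by (simp add: Esup_def nn_integral_add)
  finally show ?thesis .
qed

text \<open>The right end \<open>\<delta> * real N\<close> is left out so that grids concatenate:
  \<open>N + m\<close> points are \<open>N\<close> points followed by a shifted grid of
  \<open>m\<close> points.\<close>

definition grid :: "real \<Rightarrow> nat \<Rightarrow> real set" where
  "grid \<delta> N = (\<lambda>k. \<delta> * real k) ` {..<N}"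

definition dsup :: "real \<Rightarrow> nat \<Rightarrow> real" where
  "dsup \<delta> N = enn2real (Esup (grid \<delta> N))"

lemma dsup_nonneg [simp]: "0 \<le> dsup \<delta> N"
  by (simp add: dsup_def)

lemma grid_subset: "0 \<le> \<delta> \<Longrightarrow> grid \<delta> N \<subseteq> {0..\<delta> * real N}"
  by (auto simp: grid_def mult_left_mono)

lemma Esup_grid: "0 < \<alpha> \<Longrightarrow> 0 \<le> \<delta> \<Longrightarrow> Esup (grid \<delta> N) = ennreal (dsup \<delta> N)"
  unfolding dsup_def using Esup_mono[OF grid_subset, of \<delta> N] Esup_interval_finite[of "\<delta> * real N"]
  by (subst ennreal_enn2real) (auto intro: le_less_trans)

lemma dsup_le_hsup:
  assumes "0 < \<alpha>" "0 \<le> \<delta>"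
  shows "dsup \<delta> N \<le> hsup (\<delta> * real N)"
  unfolding dsup_def hsup_def using assms Esup_interval_finite grid_subset
  by (intro enn2real_mono Esup_mono) auto

text \<open>Each further block adds at most one block error, by \<open>Esup_exchange\<close> and
  shift invariance. Hence the error per unit length over many blocks never exceeds that of one
  block.\<close>

lemma hsup_minus_dsup_le:
  assumes \<alpha>: "0 < \<alpha>" and \<delta>: "0 \<le> \<delta>"
  shows "hsup (\<delta> * real (Suc n * m)) - dsup \<delta> (Suc n * m) \<le> real (Suc n) * (hsup (\<delta> * real m) - dsup \<delta> m)"
proof (induction n)
  case (Suc n)
  let ?N = "Suc n * m"
  have N: "Suc (Suc n) * m = ?N + m" by simp
  let ?s = "\<delta> * real ?N"
  have A: "{0..\<delta> * real (?N + m)} = {0..?s} \<union> (+) ?s ` {0..\<delta> * real m}"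
    unfolding of_nat_add distrib_left using \<delta> by (intro interval_split) simp_all
  have "(+) k ` {..<m} = {k..<k + m}" for k
    unfolding lessThan_atLeast0 by (simp add: add.commute)
  then have "{..<k + m} = {..<k} \<union> (+) k ` {..<m}" for k
    by auto
  then have B: "grid \<delta> (?N + m) = grid \<delta> ?N \<union> (+) ?s ` grid \<delta> m"
    unfolding grid_def by (simp add: image_Un image_image distrib_left)
  have "Esup {0..\<delta> * real (?N + m)} + Esup (grid \<delta> ?N) + Esup ((+) ?s ` grid \<delta> m)
     \<le> Esup (grid \<delta> (?N + m)) + Esup {0..?s} + Esup ((+) ?s ` {0..\<delta> * real m})"
    unfolding A B using \<delta> by (intro Esup_exchange \<alpha> grid_subset image_mono)
  then have "hsup (\<delta> * real (?N + m)) + dsup \<delta> ?N + dsup \<delta> m \<le> dsup \<delta> (?N + m) + hsup ?s + hsup (\<delta> * real m)"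
    unfolding Esup_shift[OF \<alpha>] Esup_eq_hsup[OF \<alpha>] Esup_grid[OF \<alpha> \<delta>]
    by (simp flip: ennreal_plus)
  then show ?case using Suc unfolding N by (simp add: algebra_simps)
qed simp

end

section \<open>Pickands constant of a grid\<close>

context standard_fbm
begin

text \<open>Strict to the left and weak to the right: on the window, the origin is the first
  maximizer.\<close>

definition stay :: "real \<Rightarrow> nat \<Rightarrow> 'a set" where
  "stay \<delta> K = {\<omega>\<in>space M. \<forall>i::int. \<bar>i\<bar> \<le> int K \<longrightarrow>
      (i < 0 \<longrightarrow> Z (\<delta> * of_int i) \<omega> < 0) \<and> (0 \<le> i \<longrightarrow> Z (\<delta> * of_int i) \<omega> \<le> 0)}"

definition stay_forever :: "real \<Rightarrow> 'a set" where
  "stay_forever \<delta> = {\<omega>\<in>space M. \<forall>i::int.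
      (i < 0 \<longrightarrow> Z (\<delta> * of_int i) \<omega> < 0) \<and> (0 \<le> i \<longrightarrow> Z (\<delta> * of_int i) \<omega> \<le> 0)}"

lemma sets_stay [measurable]: "stay \<delta> K \<in> sets M" "stay_forever \<delta> \<in> sets M"
  unfolding stay_def stay_forever_def by measurable

lemma prob_stay_tendsto: "(\<lambda>K. prob (stay \<delta> K)) \<longlonglongrightarrow> prob (stay_forever \<delta>)"
proof -
  have "(\<Inter>K. stay \<delta> K) = stay_forever \<delta>"
  proof (intro antisym subsetI)
    fix \<omega> assume \<omega>: "\<omega> \<in> (\<Inter>K. stay \<delta> K)"
    then have "\<omega> \<in> stay \<delta> (nat \<bar>i\<bar>)" for i by blast
    then show "\<omega> \<in> stay_forever \<delta>"
      unfolding stay_def stay_forever_def by auto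
  qed (auto simp: stay_def stay_forever_def)
  moreover have "decseq (stay \<delta>)"
    by (auto simp: decseq_def stay_def)
  ultimately show ?thesis
    using finite_Lim_measure_decseq[of "stay \<delta>"] by (simp add: image_subset_iff sets_stay)
qed

text \<open>Decompose the maximum over the grid according to its first maximizer \<open>j\<close>; tilting by
  \<open>exp (Z (\<delta> j))\<close> recenters the process at \<open>\<delta> j\<close>.\<close>

lemma dsup_eq_sum:
  assumes \<alpha>: "0 < \<alpha>" and \<delta>: "0 \<le> \<delta>" and N: "0 < N"
  shows "dsup \<delta> N = (\<Sum>j<N. prob {\<omega>\<in>space M. \<forall>k\<in>{..<N}. (k < j \<longrightarrow> Z (\<delta> * real k - \<delta> * real j) \<omega> < 0) \<and>
     (j \<le> k \<longrightarrow> Z (\<delta> * real k - \<delta> * real j) \<omega> \<le> 0)})"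
proof -
  define C where "C j x = (\<forall>k\<in>{..<N}. (k < j \<longrightarrow> x (\<delta> * real k) < 0) \<and> (j \<le> k \<longrightarrow> x (\<delta> * real k) \<le> 0))"
    for j and x :: "real \<Rightarrow> real"
  define F :: "nat \<Rightarrow> (real \<Rightarrow> real) \<Rightarrow> ennreal" where "F j x = (if C j x then 1 else 0)" for j x
  have Fm [measurable]: "F j \<in> borel_measurable (\<Pi>\<^sub>M t\<in>UNIV. borel)" for j
    unfolding F_def[abs_def] C_def by measurable
  have es: "esup (grid \<delta> N) \<omega> = (\<Sum>j<N. ennreal (exp (Z (\<delta> * real j) \<omega>)) * F j (\<lambda>s. Z s \<omega> - Z (\<delta> * real j) \<omega>))"
    if \<omega>: "\<omega> \<in> space M" for \<omega>
  proof -
    define z where "z j = Z (\<delta> * real j) \<omega>" for j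
    have "\<exists>j. j < N \<and> (\<forall>k<N. z k \<le> z j)"
    proof -
      have "Max (z ` {..<N}) \<in> z ` {..<N}" using N by (intro Max_in) auto
      then obtain j where "j < N" "Max (z ` {..<N}) = z j" by auto
      moreover have "z k \<le> Max (z ` {..<N})" if "k < N" for k using that by (intro Max_ge) auto
      ultimately show ?thesis by auto
    qed
    then obtain j0 where j0: "j0 < N" "\<And>k. k < N \<Longrightarrow> z k \<le> z j0" and least: "\<And>j. j < j0 \<Longrightarrow> \<not> (j < N \<and> (\<forall>k<N. z k \<le> z j))"
      using exists_least_iff[of "\<lambda>j. j < N \<and> (\<forall>k<N. z k \<le> z j)"] by blast
    \<comment> \<open>Exactly one index is a first maximizer, so the sum over \<open>j\<close> has a
      single nonzero term, the maximum itself.\<close>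
    have iff: "C j (\<lambda>s. Z s \<omega> - Z (\<delta> * real j) \<omega>) \<longleftrightarrow> j = j0" if j: "j < N" for j
    proof
      assume "C j (\<lambda>s. Z s \<omega> - Z (\<delta> * real j) \<omega>)"
      then have c: "\<And>k. k < N \<Longrightarrow> k < j \<Longrightarrow> z k < z j" "\<And>k. k < N \<Longrightarrow> j \<le> k \<Longrightarrow> z k \<le> z j"
        by (auto simp: C_def z_def)
      then have "z k \<le> z j" if "k < N" for k using that by (cases "k < j") (auto intro: less_imp_le)
      then have "\<not> j < j0" using least j by blast
      moreover have "\<not> j0 < j" using c(1)[OF j0(1)] j0(2)[OF j] by auto
      ultimately show "j = j0" by simp
    next
      assume "j = j0"
      have "z k < z j0" if kj: "k < j0" for k
      proof -
        have "k < N" using kj j0 by simp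
        then obtain l where "l < N" "z k < z l" using least[OF kj] by (auto simp: not_le)
        then show ?thesis using j0(2)[of l] by simp
      qed
      then show "C j (\<lambda>s. Z s \<omega> - Z (\<delta> * real j) \<omega>)"
        using j0(2) unfolding \<open>j = j0\<close> C_def z_def by auto
    qed
    have "(\<Sum>j<N. ennreal (exp (Z (\<delta> * real j) \<omega>)) * F j (\<lambda>s. Z s \<omega> - Z (\<delta> * real j) \<omega>))
      = (\<Sum>j<N. if j = j0 then ennreal (exp (z j)) else 0)"
      unfolding F_def using iff by (intro sum.cong) (auto simp: z_def)
    also have "\<dots> = ennreal (exp (z j0))" using j0(1) by simp
    also have "\<dots> = esup (grid \<delta> N) \<omega>"
      unfolding esup_def grid_def image_image z_def[symmetric] using j0
      by (intro antisym SUP_least SUP_upper2[of j0]) (auto intro!: ennreal_leI)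
    finally show ?thesis by simp
  qed
  have "(\<lambda>\<omega> s. Z s \<omega> - Z t \<omega>) \<in> measurable M (\<Pi>\<^sub>M t\<in>UNIV. borel)"
    "(\<lambda>\<omega> s. Z (s - t) \<omega>) \<in> measurable M (\<Pi>\<^sub>M t\<in>UNIV. borel)" for t
    by (auto intro!: measurable_PiM_single')
  then have [measurable]: "(\<lambda>\<omega>. F j (\<lambda>s. Z s \<omega> - Z t \<omega>)) \<in> borel_measurable M"
    "(\<lambda>\<omega>. F j (\<lambda>s. Z (s - t) \<omega>)) \<in> borel_measurable M" for j t
    using measurable_compose[OF _ Fm] by blast+
  have "Esup (grid \<delta> N) = (\<integral>\<^sup>+\<omega>. (\<Sum>j<N. ennreal (exp (Z (\<delta> * real j) \<omega>)) * F j (\<lambda>s. Z s \<omega> - Z (\<delta> * real j) \<omega>)) \<partial>M)"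
    unfolding Esup_def by (intro nn_integral_cong es)
  also have "\<dots> = (\<Sum>j<N. \<integral>\<^sup>+\<omega>. F j (\<lambda>s. Z (s - \<delta> * real j) \<omega>) \<partial>M)"
    by (simp add: nn_integral_sum nn_integral_shift)
  also have "\<dots> = (\<Sum>j<N. \<integral>\<^sup>+\<omega>. indicator {\<omega>\<in>space M. C j (\<lambda>s. Z (s - \<delta> * real j) \<omega>)} \<omega> \<partial>M)"
    by (intro sum.cong nn_integral_cong refl) (auto simp: F_def indicator_def)
  also have "\<dots> = (\<Sum>j<N. ennreal (prob {\<omega>\<in>space M. C j (\<lambda>s. Z (s - \<delta> * real j) \<omega>)}))"
    unfolding C_def by (intro sum.cong refl, subst nn_integral_indicator) (measurable, simp add: emeasure_eq_measure)
  also have "\<dots> = ennreal (\<Sum>j<N. prob {\<omega>\<in>space M. C j (\<lambda>s. Z (s - \<delta> * real j) \<omega>)})"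
    by simp
  finally show ?thesis
    unfolding dsup_def C_def by (simp add: sum_nonneg)
qed

text \<open>Each summand of \<open>dsup_eq_sum\<close> imposes only the constraints at the offsets
  \<open>k - j\<close>, a finite part of those in \<open>stay_forever\<close>.\<close>

lemma prob_stay_forever_le:
  assumes \<alpha>: "0 < \<alpha>" and \<delta>: "0 \<le> \<delta>"
  shows "real N * prob (stay_forever \<delta>) \<le> dsup \<delta> N"
proof (cases "N = 0")
  case False
  have "prob (stay_forever \<delta>) \<le> prob {\<omega>\<in>space M. \<forall>k\<in>{..<N}. (k < j \<longrightarrow> Z (\<delta> * real k - \<delta> * real j) \<omega> < 0) \<and>
     (j \<le> k \<longrightarrow> Z (\<delta> * real k - \<delta> * real j) \<omega> \<le> 0)}" for j
  proof (intro finite_measure_mono subsetI)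
    fix \<omega> assume "\<omega> \<in> stay_forever \<delta>"
    then have \<omega>: "\<omega> \<in> space M" and s: "(i < 0 \<longrightarrow> Z (\<delta> * of_int i) \<omega> < 0) \<and> (0 \<le> i \<longrightarrow> Z (\<delta> * of_int i) \<omega> \<le> 0)" for i
      unfolding stay_forever_def by auto
    show "\<omega> \<in> {\<omega>\<in>space M. \<forall>k\<in>{..<N}. (k < j \<longrightarrow> Z (\<delta> * real k - \<delta> * real j) \<omega> < 0) \<and>
     (j \<le> k \<longrightarrow> Z (\<delta> * real k - \<delta> * real j) \<omega> \<le> 0)}"
      using \<omega> s[of "int k - int j" for k] by (auto simp: right_diff_distrib)
  qed measurable
  then have "(\<Sum>j<N. prob (stay_forever \<delta>)) \<le> dsup \<delta> N"
    unfolding dsup_eq_sum[OF \<alpha> \<delta> False[unfolded neq0_conv]] by (intro sum_mono)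
  then show ?thesis by simp
qed simp

text \<open>An index at distance at least \<open>K\<close> from both ends sees the whole window, so
  its probability is at most that of \<open>stay\<close>; the remaining indices, at most
  \<open>2 * K\<close>, are bounded by 1.\<close>

lemma dsup_le_prob_stay:
  assumes \<alpha>: "0 < \<alpha>" and \<delta>: "0 \<le> \<delta>"
  shows "dsup \<delta> N \<le> 2 * real K + real N * prob (stay \<delta> K)"
proof (cases "N = 0")
  case True
  then have "dsup \<delta> N = 0" by (simp add: dsup_def grid_def Esup_def esup_def bot_ennreal)
  then show ?thesis by simp
next
  case False
  let ?p = "\<lambda>j. prob {\<omega>\<in>space M. \<forall>k\<in>{..<N}. (k < j \<longrightarrow> Z (\<delta> * real k - \<delta> * real j) \<omega> < 0) \<and>
     (j \<le> k \<longrightarrow> Z (\<delta> * real k - \<delta> * real j) \<omega> \<le> 0)}"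
  have le: "?p j \<le> (if j < K \<or> N \<le> j + K then 1 else 0) + prob (stay \<delta> K)" for j
  proof (cases "j < K \<or> N \<le> j + K")
    case True
    then show ?thesis by (simp add: add_increasing2)
  next
    case nb: False
    have "?p j \<le> prob (stay \<delta> K)"
    proof (intro finite_measure_mono subsetI)
      fix \<omega> assume "\<omega> \<in> {\<omega>\<in>space M. \<forall>k\<in>{..<N}. (k < j \<longrightarrow> Z (\<delta> * real k - \<delta> * real j) \<omega> < 0) \<and>
         (j \<le> k \<longrightarrow> Z (\<delta> * real k - \<delta> * real j) \<omega> \<le> 0)}"
      then have \<omega>: "\<omega> \<in> space M" and s: "\<And>k. k < N \<Longrightarrow> (k < j \<longrightarrow> Z (\<delta> * real k - \<delta> * real j) \<omega> < 0) \<and>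
         (j \<le> k \<longrightarrow> Z (\<delta> * real k - \<delta> * real j) \<omega> \<le> 0)" by auto
      have "(i < 0 \<longrightarrow> Z (\<delta> * of_int i) \<omega> < 0) \<and> (0 \<le> i \<longrightarrow> Z (\<delta> * of_int i) \<omega> \<le> 0)" if "\<bar>i\<bar> \<le> int K" for i
      proof -
        define k where "k = nat (int j + i)"
        have jK: "int K \<le> int j" "int j + int K < int N" using nb by auto
        have k: "int k = int j + i" unfolding k_def using that jK by simp
        then have kN: "k < N" and kj: "k < j \<longleftrightarrow> i < 0" "j \<le> k \<longleftrightarrow> 0 \<le> i"
          using that jK by linarith+
        have "real k = real j + of_int i"
          using arg_cong[OF k, of real_of_int] by simp
        then have "\<delta> * real k - \<delta> * real j = \<delta> * of_int i" by (simp add: distrib_left)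
        then show ?thesis using s[OF kN] kj by simp
      qed
      then show "\<omega> \<in> stay \<delta> K" unfolding stay_def using \<omega> by auto
    qed measurable
    then show ?thesis using nb by simp
  qed
  have "dsup \<delta> N \<le> (\<Sum>j<N. (if j < K \<or> N \<le> j + K then 1 else 0) + prob (stay \<delta> K))"
    unfolding dsup_eq_sum[OF \<alpha> \<delta> False[unfolded neq0_conv]] by (intro sum_mono le)
  also have "\<dots> = real (card {j\<in>{..<N}. j < K \<or> N \<le> j + K}) + real N * prob (stay \<delta> K)"
    by (simp add: sum.distrib flip: sum.inter_filter)
  also have "card {j\<in>{..<N}. j < K \<or> N \<le> j + K} \<le> card ({..<K} \<union> {N - K..<N})"
    by (intro card_mono) auto
  also have "card ({..<K} \<union> {N - K..<N}) \<le> 2 * K"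
    using card_Un_le[of "{..<K}" "{N - K..<N}"] by simp
  finally show ?thesis by simp
qed

text \<open>For the upper bound the window \<open>K\<close> is fixed first; then \<open>N\<close>
  grows and the boundary term \<open>2 * K / N\<close> disappears.\<close>

lemma dsup_over_N_tendsto:
  assumes \<alpha>: "0 < \<alpha>" and \<delta>: "0 \<le> \<delta>"
  shows "(\<lambda>N. dsup \<delta> N / real N) \<longlonglongrightarrow> prob (stay_forever \<delta>)"
proof (rule order_tendstoI)
  fix l assume l: "l < prob (stay_forever \<delta>)"
  have "prob (stay_forever \<delta>) \<le> dsup \<delta> N / real N" if "0 < N" for N
    using prob_stay_forever_le[OF \<alpha> \<delta>, of N] that by (simp add: field_simps)
  then show "eventually (\<lambda>N. l < dsup \<delta> N / real N) sequentially"
    using l by (intro eventually_mono[OF eventually_gt_at_top[of 0]]) (rule less_le_trans)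
next
  fix u assume u: "prob (stay_forever \<delta>) < u"
  obtain K where K: "prob (stay \<delta> K) < u"
    using order_tendstoD(2)[OF prob_stay_tendsto u] by (auto simp: eventually_sequentially)
  have "(\<lambda>N. 2 * real K / real N + prob (stay \<delta> K)) \<longlonglongrightarrow> 0 + prob (stay \<delta> K)"
    by (intro tendsto_intros lim_const_over_n)
  then have "eventually (\<lambda>N. 2 * real K / real N + prob (stay \<delta> K) < u) sequentially"
    using K by (intro order_tendstoD) auto
  then show "eventually (\<lambda>N. dsup \<delta> N / real N < u) sequentially"
    using eventually_gt_at_top[of 0]
  proof eventually_elim
    case (elim N)
    have "dsup \<delta> N / real N \<le> (2 * real K + real N * prob (stay \<delta> K)) / real N"
      using dsup_le_prob_stay[OF \<alpha> \<delta>] by (intro divide_right_mono) auto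
    also have "\<dots> = 2 * real K / real N + prob (stay \<delta> K)" using elim by (simp add: field_simps)
    finally show ?case using elim by simp
  qed
qed

text \<open>Away from time 0 the variance is positive, and a normal law has no atoms.\<close>

lemma AE_Z_nonzero:
  assumes "t \<noteq> 0"
  shows "AE \<omega> in M. Z t \<omega> \<noteq> 0"
proof -
  have v: "expectation (\<lambda>\<omega>. (B t \<omega>)\<^sup>2) > 0" using assms by (simp add: expectation_B_square)
  let ?v = "expectation (\<lambda>\<omega>. (B t \<omega>)\<^sup>2)"
  have D: "distributed M lborel (B t) (\<lambda>x. ennreal (normal_density 0 (sqrt ?v) x))"
    using centered_gaussian_rv_cases(2)[OF gaussian_rv_G[OF B_in_span] expectation_G[OF B_in_span], of t] v by auto
  have "AE x in distr M lborel (B t). x \<noteq> \<bar>t\<bar> powr \<alpha> / sqrt 2"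
    unfolding distributed_distr_eq_density[OF D]
    using AE_lborel_singleton[of "\<bar>t\<bar> powr \<alpha> / sqrt 2"] by (subst AE_density) auto
  then have "AE \<omega> in M. B t \<omega> \<noteq> \<bar>t\<bar> powr \<alpha> / sqrt 2"
    by (subst (asm) AE_distr_iff) auto
  then show ?thesis
    by eventually_elim (auto simp: Z_def field_simps)
qed

lemma Z_0: "\<omega> \<in> space M \<Longrightarrow> Z 0 \<omega> = 0"
  by (simp add: Z_def starts_at_0)

text \<open>Ties with the value at the origin have probability zero at each of the countably many
  other grid points, so the asymmetry between the two sides vanishes.\<close>

lemma prob_stay_forever:
  assumes \<delta>: "0 < \<delta>"
  shows "prob (stay_forever \<delta>) = prob {\<omega>\<in>space M. \<forall>i::int. i \<noteq> 0 \<longrightarrow> Z (\<delta> * of_int i) \<omega> \<le> 0}"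
proof (rule finite_measure_eq_AE)
  have "AE \<omega> in M. \<forall>i::int. i \<noteq> 0 \<longrightarrow> Z (\<delta> * of_int i) \<omega> \<noteq> 0"
    unfolding AE_all_countable using \<delta> by (auto intro!: AE_Z_nonzero)
  then show "AE \<omega> in M. \<omega> \<in> stay_forever \<delta> \<longleftrightarrow> \<omega> \<in> {\<omega>\<in>space M. \<forall>i::int. i \<noteq> 0 \<longrightarrow> Z (\<delta> * of_int i) \<omega> \<le> 0}"
  proof (eventually_elim)
    case (elim \<omega>)
    show ?case
    proof (intro iffI)
      assume "\<omega> \<in> stay_forever \<delta>"
      then show "\<omega> \<in> {\<omega>\<in>space M. \<forall>i::int. i \<noteq> 0 \<longrightarrow> Z (\<delta> * of_int i) \<omega> \<le> 0}"
        unfolding stay_forever_def using not_le less_imp_le by blast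
    next
      assume \<omega>: "\<omega> \<in> {\<omega>\<in>space M. \<forall>i::int. i \<noteq> 0 \<longrightarrow> Z (\<delta> * of_int i) \<omega> \<le> 0}"
      then have "Z (\<delta> * of_int i) \<omega> \<le> 0" for i :: int
        by (cases "i = 0") (auto simp: Z_0)
      moreover have "Z (\<delta> * of_int i) \<omega> \<noteq> 0" if "i < 0" for i :: int using that elim by auto
      ultimately show "\<omega> \<in> stay_forever \<delta>"
        unfolding stay_forever_def using \<omega> by (auto simp: less_le)
    qed
  qed
qed measurable

end

section \<open>Refining the grid and time inversion\<close>

context standard_fbm
begin

lemma hsup_grid_tendsto:
  assumes \<alpha>: "0 < \<alpha>" and \<delta>: "0 < \<delta>"
  shows "(\<lambda>N. hsup (\<delta> * real N) / (\<delta> * real N)) \<longlonglongrightarrow> pickands_constant M \<alpha> B"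
  by (intro filterlim_compose[OF hsup_tendsto_pickands[OF \<alpha>]] filterlim_tendsto_pos_mult_at_top[OF tendsto_const]
      filterlim_real_sequentially \<delta>)

lemma dsup_grid_tendsto:
  assumes \<alpha>: "0 < \<alpha>" and \<delta>: "0 < \<delta>"
  shows "(\<lambda>N. dsup \<delta> N / (\<delta> * real N)) \<longlonglongrightarrow> prob (stay_forever \<delta>) / \<delta>"
proof -
  have "(\<lambda>N. dsup \<delta> N / real N / \<delta>) \<longlonglongrightarrow> prob (stay_forever \<delta>) / \<delta>"
    using \<delta> by (intro tendsto_intros dsup_over_N_tendsto[OF \<alpha>]) auto
  then show ?thesis by (simp add: mult.commute)
qed

lemma prob_stay_forever_le_pickands:
  assumes \<alpha>: "0 < \<alpha>" and \<delta>: "0 < \<delta>"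
  shows "prob (stay_forever \<delta>) / \<delta> \<le> pickands_constant M \<alpha> B"
  using dsup_le_hsup[OF \<alpha> less_imp_le[OF \<delta>]] \<delta>
  by (intro LIMSEQ_le[OF dsup_grid_tendsto[OF \<alpha> \<delta>] hsup_grid_tendsto[OF \<alpha> \<delta>]])
    (auto intro!: divide_right_mono)

text \<open>Along horizons of \<open>Suc n\<close> blocks the error per unit length is bounded
  independently of \<open>n\<close>, and the bound survives the limit. An error on a bounded horizon
  thus controls the difference of two limits at infinity.\<close>

lemma pickands_minus_prob_stay_forever_le:
  assumes \<alpha>: "0 < \<alpha>" and \<delta>: "0 < \<delta>" and m: "0 < m"
  shows "pickands_constant M \<alpha> B - prob (stay_forever \<delta>) / \<delta> \<le> (hsup (\<delta> * real m) - dsup \<delta> m) / (\<delta> * real m)"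
proof (rule LIMSEQ_le_const2)
  have sm: "strict_mono (\<lambda>n. Suc n * m)"
    using m by (intro strict_monoI) simp
  show "(\<lambda>n. hsup (\<delta> * real (Suc n * m)) / (\<delta> * real (Suc n * m)) - dsup \<delta> (Suc n * m) / (\<delta> * real (Suc n * m)))
    \<longlonglongrightarrow> pickands_constant M \<alpha> B - prob (stay_forever \<delta>) / \<delta>"
    using LIMSEQ_subseq_LIMSEQ[OF hsup_grid_tendsto[OF \<alpha> \<delta>] sm] LIMSEQ_subseq_LIMSEQ[OF dsup_grid_tendsto[OF \<alpha> \<delta>] sm]
    by (intro tendsto_diff) (simp_all add: o_def)
  show "\<exists>N. \<forall>n\<ge>N. hsup (\<delta> * real (Suc n * m)) / (\<delta> * real (Suc n * m)) - dsup \<delta> (Suc n * m) / (\<delta> * real (Suc n * m))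
     \<le> (hsup (\<delta> * real m) - dsup \<delta> m) / (\<delta> * real m)"
  proof (intro exI allI impI)
    fix n
    have "hsup (\<delta> * real (Suc n * m)) / (\<delta> * real (Suc n * m)) - dsup \<delta> (Suc n * m) / (\<delta> * real (Suc n * m))
       = (hsup (\<delta> * real (Suc n * m)) - dsup \<delta> (Suc n * m)) / (\<delta> * real (Suc n * m))"
      by (simp only: diff_divide_distrib)
    also have "\<dots> \<le> real (Suc n) * (hsup (\<delta> * real m) - dsup \<delta> m) / (\<delta> * real (Suc n * m))"
      using \<delta> hsup_minus_dsup_le[OF \<alpha>, of \<delta> n m] by (intro divide_right_mono) auto
    also have "\<dots> = (real (Suc n) * (hsup (\<delta> * real m) - dsup \<delta> m)) / (real (Suc n) * (\<delta> * real m))"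
      by (simp only: of_nat_mult mult_ac)
    also have "\<dots> = (hsup (\<delta> * real m) - dsup \<delta> m) / (\<delta> * real m)"
      by (rule mult_divide_mult_cancel_left) simp
    finally show "hsup (\<delta> * real (Suc n * m)) / (\<delta> * real (Suc n * m)) - dsup \<delta> (Suc n * m) / (\<delta> * real (Suc n * m))
     \<le> (hsup (\<delta> * real m) - dsup \<delta> m) / (\<delta> * real m)" .
  qed
qed

lemma integrable_SUP_exp_Z:
  assumes \<alpha>: "0 < \<alpha>" and S: "compact S" "S \<noteq> {}" "S \<subseteq> {0..T}"
  shows "integrable M (\<lambda>\<omega>. SUP t\<in>S. exp (Z t \<omega>))"
proof (rule integrableI_bounded)
  have "(\<integral>\<^sup>+\<omega>. ennreal (norm (SUP t\<in>S. exp (Z t \<omega>))) \<partial>M) = Esup S"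
    unfolding Esup_def using esup_compact[OF \<alpha> _ S(1,2)]
    by (intro nn_integral_cong) (metis abs_of_nonneg exp_ge_zero real_norm_def)
  also have "\<dots> < \<infinity>"
    using Esup_mono[OF S(3)] Esup_interval_finite[OF \<alpha>] by (metis infinity_ennreal_def le_less_trans)
  finally show "(\<integral>\<^sup>+\<omega>. ennreal (norm (SUP t\<in>S. exp (Z t \<omega>))) \<partial>M) < \<infinity>" .
qed (rule expectation_SUP_exp_Z(1)[OF \<alpha> S(1,2)])

lemma grid_point_near:
  assumes \<delta>: "0 < \<delta>" and m: "0 < m" and t: "t \<in> {0..\<delta> * real m}"
  obtains s where "s \<in> grid \<delta> m" "\<bar>t - s\<bar> \<le> \<delta>"
proof -
  \<comment> \<open>The cap at \<open>m - 1\<close> is the last grid point; beyond it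
    \<open>t\<close> is still within one mesh.\<close>
  define k where "k = min (m - 1) (nat \<lfloor>t / \<delta>\<rfloor>)"
  have td: "0 \<le> t / \<delta>" "t / \<delta> \<le> real m" using t \<delta> by (auto simp: pos_divide_le_eq mult.commute)
  have "\<bar>t / \<delta> - real k\<bar> \<le> 1"
  proof (cases "nat \<lfloor>t / \<delta>\<rfloor> \<le> m - 1")
    case True
    then have "real k = of_int \<lfloor>t / \<delta>\<rfloor>" using td by (simp add: k_def)
    then show ?thesis by linarith
  next
    case False
    then have "k = m - 1" "int m \<le> \<lfloor>t / \<delta>\<rfloor>" by (simp_all add: k_def)
    then have "real k = real m - 1" "real m \<le> t / \<delta>" using m by (simp_all add: of_nat_diff le_floor_iff)
    then show ?thesis using td by linarith
  qed
  moreover have "t - \<delta> * real k = \<delta> * (t / \<delta> - real k)" using \<delta> by (simp add: field_simps)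
  ultimately have "\<bar>t - \<delta> * real k\<bar> \<le> \<delta>"
    using \<delta> by (simp add: abs_mult mult_left_le)
  moreover have "\<delta> * real k \<in> grid \<delta> m" unfolding grid_def k_def using m by auto
  ultimately show ?thesis by (rule that[rotated])
qed

text \<open>With \<open>nat \<lceil>1 / \<delta>\<rceil>\<close> points the block has length between
  1 and 2 for small \<open>\<delta>\<close>. The error tends to 0 on each path by uniform
  continuity, dominated by the integrable supremum over \<open>{0..2}\<close>.\<close>

lemma hsup_minus_dsup_tendsto:
  assumes \<alpha>: "0 < \<alpha>"
  shows "((\<lambda>\<delta>. hsup (\<delta> * real (nat \<lceil>1 / \<delta>\<rceil>)) - dsup \<delta> (nat \<lceil>1 / \<delta>\<rceil>)) \<longlongrightarrow> 0) (at_right 0)"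
proof (rule tendsto_at_right_sequentially[of 0 1])
  fix \<delta> :: "nat \<Rightarrow> real"
  assume \<delta>: "\<And>n. 0 < \<delta> n" "\<And>n. \<delta> n < 1" and lim: "\<delta> \<longlonglongrightarrow> 0"
  define m where "m n = nat \<lceil>1 / \<delta> n\<rceil>" for n
  have m1: "1 / \<delta> n \<le> real (m n)" "real (m n) \<le> 1 / \<delta> n + 1" for n
    unfolding m_def using \<delta>(1)[of n] by (simp_all add: of_nat_nat)
  have m0: "0 < m n" for n
    using m1(1)[of n] \<delta>(1)[of n] by (cases "m n") (auto simp: divide_le_0_iff)
  have m2: "\<delta> n * real (m n) \<le> 2" for n
  proof -
    have "\<delta> n * real (m n) \<le> \<delta> n * (1 / \<delta> n + 1)" using m1(2)[of n] \<delta>(1)[of n] by (intro mult_left_mono) auto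
    also have "\<dots> \<le> 2" using \<delta>[of n] by (simp add: distrib_left)
    finally show ?thesis .
  qed
  let ?I = "\<lambda>n. {0..\<delta> n * real (m n)}" and ?G = "\<lambda>n. grid (\<delta> n) (m n)"
  have I: "compact (?I n)" "?I n \<noteq> {}" "?I n \<subseteq> {0..2}" for n
    using \<delta>(1)[of n] m2[of n] by auto
  have GI: "?G n \<subseteq> ?I n" for n using grid_subset \<delta>(1)[of n] by auto
  have G: "compact (?G n)" "?G n \<noteq> {}" "?G n \<subseteq> {0..2}" for n
    using GI[of n] I(3)[of n] m0[of n] by (auto simp: grid_def intro!: finite_imp_compact)
  define f where "f n \<omega> = (SUP t\<in>?I n. exp (Z t \<omega>)) - (SUP t\<in>?G n. exp (Z t \<omega>))" for n \<omega>
  have fm: "f n \<in> borel_measurable M" for n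
    unfolding f_def[abs_def] using expectation_SUP_exp_Z(1)[OF \<alpha> I(1,2)] expectation_SUP_exp_Z(1)[OF \<alpha> G(1,2)]
    by (intro borel_measurable_diff)
  have Ef: "expectation (f n) = hsup (\<delta> n * real (m n)) - dsup (\<delta> n) (m n)" for n
    unfolding f_def[abs_def] hsup_def dsup_def
      expectation_SUP_exp_Z(2)[OF \<alpha> I(1,2), symmetric] expectation_SUP_exp_Z(2)[OF \<alpha> G(1,2), symmetric]
    by (intro Bochner_Integration.integral_diff integrable_SUP_exp_Z[OF \<alpha> I] integrable_SUP_exp_Z[OF \<alpha> G])
  \<comment> \<open>The last claim compares the maximizer on the interval with every grid point, so
    a nearby one may be chosen instead of the maximizer on the grid.\<close>
  have f0: "0 \<le> f n \<omega>" and fub: "f n \<omega> \<le> (SUP t\<in>{0..2}. exp (Z t \<omega>))"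
    and fnear: "\<exists>s\<in>?I n. \<forall>r\<in>?G n. f n \<omega> \<le> exp (Z s \<omega>) - exp (Z r \<omega>)" if \<omega>: "\<omega> \<in> space M" for n \<omega>
  proof -
    obtain s where s: "s \<in> ?I n" "\<And>r. r \<in> ?I n \<Longrightarrow> Z r \<omega> \<le> Z s \<omega>" "(SUP t\<in>?I n. exp (Z t \<omega>)) = exp (Z s \<omega>)"
      using esup_compact[OF \<alpha> \<omega> I(1,2)] by metis
    obtain t where t: "t \<in> ?G n" "\<And>r. r \<in> ?G n \<Longrightarrow> Z r \<omega> \<le> Z t \<omega>" "(SUP t\<in>?G n. exp (Z t \<omega>)) = exp (Z t \<omega>)"
      using esup_compact[OF \<alpha> \<omega> G(1,2)] by metis
    have ne: "{0..2 :: real} \<noteq> {}" by simp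
    obtain u where u: "\<And>r. r \<in> {0..2} \<Longrightarrow> Z r \<omega> \<le> Z u \<omega>" "(SUP t\<in>{0..2}. exp (Z t \<omega>)) = exp (Z u \<omega>)"
      using esup_compact[OF \<alpha> \<omega> compact_Icc ne] by metis
    have fe: "f n \<omega> = exp (Z s \<omega>) - exp (Z t \<omega>)" by (simp only: f_def s(3) t(3))
    show "0 \<le> f n \<omega>" unfolding fe using s(2)[OF subsetD[OF GI t(1)]] by simp
    have "exp (Z s \<omega>) \<le> exp (Z u \<omega>)" using u(1)[OF subsetD[OF I(3) s(1)]] by simp
    then show "f n \<omega> \<le> (SUP t\<in>{0..2}. exp (Z t \<omega>))"
      unfolding fe u(2) using exp_ge_zero[of "Z t \<omega>"] by linarith
    show "\<exists>s\<in>?I n. \<forall>r\<in>?G n. f n \<omega> \<le> exp (Z s \<omega>) - exp (Z r \<omega>)"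
      unfolding fe using s(1) t(2) by (intro bexI[of _ s]) auto
  qed
  have ptw: "(\<lambda>n. f n \<omega>) \<longlonglongrightarrow> 0" if \<omega>: "\<omega> \<in> space M" for \<omega>
  proof (rule LIMSEQ_I)
    fix e :: real assume e: "0 < e"
    have "uniformly_continuous_on {0..2} (\<lambda>t. exp (Z t \<omega>))"
      by (intro compact_uniformly_continuous continuous_on_exp continuous_on_subset[OF continuous_on_Z[OF \<alpha> \<omega>]]) auto
    then obtain d where d: "0 < d" "\<And>s t. s \<in> {0..2} \<Longrightarrow> t \<in> {0..2} \<Longrightarrow> \<bar>s - t\<bar> < d \<Longrightarrow> \<bar>exp (Z s \<omega>) - exp (Z t \<omega>)\<bar> < e"
      unfolding uniformly_continuous_on_def dist_real_def using e by metis
    obtain N where N: "\<And>n. n \<ge> N \<Longrightarrow> \<delta> n < d"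
      using order_tendstoD(2)[OF lim d(1)] by (auto simp: eventually_sequentially)
    show "\<exists>N. \<forall>n\<ge>N. norm (f n \<omega> - 0) < e"
    proof (intro exI allI impI)
      fix n assume "N \<le> n"
      obtain s where s: "s \<in> ?I n" "\<And>r. r \<in> ?G n \<Longrightarrow> f n \<omega> \<le> exp (Z s \<omega>) - exp (Z r \<omega>)"
        using fnear[OF \<omega>] by blast
      obtain r where r: "r \<in> ?G n" "\<bar>s - r\<bar> \<le> \<delta> n"
        using grid_point_near[OF \<delta>(1) m0 s(1)] by blast
      have "\<bar>exp (Z s \<omega>) - exp (Z r \<omega>)\<bar> < e"
        using r(2) N[OF \<open>N \<le> n\<close>] by (intro d(2) subsetD[OF I(3) s(1)] subsetD[OF G(3) r(1)]) linarith
      then show "norm (f n \<omega> - 0) < e" using s(2)[OF r(1)] f0[OF \<omega>, of n] by simp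
    qed
  qed
  have "(\<lambda>n. expectation (f n)) \<longlonglongrightarrow> expectation (\<lambda>_. 0)"
  proof (rule integral_dominated_convergence[where w="\<lambda>\<omega>. SUP t\<in>{0..2}. exp (Z t \<omega>)"])
    show "integrable M (\<lambda>\<omega>. SUP t\<in>{0..2}. exp (Z t \<omega>))"
      by (rule integrable_SUP_exp_Z[OF \<alpha>, of _ 2]) auto
  qed (use fm ptw f0 fub in auto)
  then show "(\<lambda>n. hsup (\<delta> n * real (nat \<lceil>1 / \<delta> n\<rceil>)) - dsup (\<delta> n) (nat \<lceil>1 / \<delta> n\<rceil>)) \<longlonglongrightarrow> 0"
    by (simp add: Ef m_def)
qed simp

lemma prob_stay_forever_tendsto:
  assumes \<alpha>: "0 < \<alpha>"
  shows "((\<lambda>\<delta>. prob (stay_forever \<delta>) / \<delta>) \<longlongrightarrow> pickands_constant M \<alpha> B) (at_right 0)"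
proof (rule tendsto_sandwich)
  let ?gap = "\<lambda>\<delta>. hsup (\<delta> * real (nat \<lceil>1 / \<delta>\<rceil>)) - dsup \<delta> (nat \<lceil>1 / \<delta>\<rceil>)"
  show "((\<lambda>\<delta>. pickands_constant M \<alpha> B - ?gap \<delta>) \<longlongrightarrow> pickands_constant M \<alpha> B) (at_right 0)"
    using tendsto_diff[OF tendsto_const hsup_minus_dsup_tendsto[OF \<alpha>]] by simp
  show "((\<lambda>\<delta>. pickands_constant M \<alpha> B) \<longlongrightarrow> pickands_constant M \<alpha> B) (at_right 0)" by simp
  show "eventually (\<lambda>\<delta>. prob (stay_forever \<delta>) / \<delta> \<le> pickands_constant M \<alpha> B) (at_right 0)"
    by (auto simp: eventually_at_right_field intro!: exI[of _ 1] prob_stay_forever_le_pickands[OF \<alpha>])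
  show "eventually (\<lambda>\<delta>. pickands_constant M \<alpha> B - ?gap \<delta> \<le> prob (stay_forever \<delta>) / \<delta>) (at_right 0)"
    unfolding eventually_at_right_field
  proof (intro exI[of _ 1] conjI allI impI)
    fix \<delta> :: real assume \<delta>: "0 < \<delta>" "\<delta> < 1"
    let ?m = "nat \<lceil>1 / \<delta>\<rceil>"
    have "1 / \<delta> \<le> real ?m" using \<delta> by (simp add: of_nat_nat)
    then have "\<delta> * (1 / \<delta>) \<le> \<delta> * real ?m" using \<delta> by (intro mult_left_mono) auto
    then have m: "1 \<le> \<delta> * real ?m" using \<delta> by simp
    then have m0: "0 < ?m" by (cases ?m) auto
    \<comment> \<open>The block has length at least 1 and the gap is nonnegative, so dividing by the
      length only decreases it.\<close>
    have "?gap \<delta> / (\<delta> * real ?m) \<le> ?gap \<delta>"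
      using m dsup_le_hsup[OF \<alpha>, of \<delta> ?m] \<delta> by (simp add: divide_le_eq mult_left_le mult_le_cancel_left1)
    then show "pickands_constant M \<alpha> B - ?gap \<delta> \<le> prob (stay_forever \<delta>) / \<delta>"
      using pickands_minus_prob_stay_forever_le[OF \<alpha> \<delta>(1) m0] by linarith
  qed simp
qed

text \<open>Time inversion: \<open>\<bar>t\<bar> powr \<alpha> * B (1 / t)\<close> has the covariance of \<open>B\<close>.\<close>

lemma prob_harmonic_le:
  assumes \<alpha>: "0 < \<alpha>" and \<eta>: "0 < \<eta>" and \<delta>_def: "\<delta> = 2 powr (1 / \<alpha>) * \<eta> powr (2 / \<alpha>)"
  shows "prob {\<omega>\<in>space M. \<forall>k::int. k \<noteq> 0 \<longrightarrow> B (1 / of_int k) \<omega> \<le> \<eta>} = prob (stay_forever \<delta>)"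
proof -
  have \<delta>: "0 < \<delta>" using \<eta> by (simp add: \<delta>_def)
  \<comment> \<open>This relation fixes the mesh: after rescaling, the level \<open>\<eta>\<close>
    turns into \<open>2 * \<eta>\<^sup>2 * \<bar>k\<bar> powr \<alpha>\<close> for
    \<open>sqrt 2 * B (\<delta> * k)\<close>, which has to equal the drift at
    \<open>\<delta> * k\<close>.\<close>
  have "\<delta> powr \<alpha> = 2 * \<eta> powr 2" using \<alpha> \<eta> by (simp add: \<delta>_def powr_mult powr_powr)
  then have \<delta>\<alpha>: "\<delta> powr \<alpha> = 2 * \<eta>\<^sup>2" using \<eta> by simp
  define c where "c = 1 / (sqrt 2 * \<eta>)"
  have c: "c > 0" "c * c * (\<delta> powr \<alpha>) = 1" using \<eta> by (simp_all add: c_def \<delta>\<alpha> power2_eq_square)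
  define X where "X k = B (1 / of_int k)" for k :: int
  \<comment> \<open>Time inversion at \<open>1 / k\<close> gives
    \<open>\<bar>k\<bar> powr (-\<alpha>) * B k\<close> in law; self-similarity then replaces
    \<open>B k\<close> by \<open>c * B (\<delta> * k)\<close>, where \<open>c\<close> restores the
    variance.\<close>
  define Y where "Y k \<omega> = (c * \<bar>of_int k\<bar> powr (-\<alpha>)) * B (\<delta> * of_int k) \<omega>" for k :: int and \<omega>
  have XY: "distr M (\<Pi>\<^sub>M t\<in>UNIV. borel) (\<lambda>\<omega> k. X k \<omega>) = distr M (\<Pi>\<^sub>M t\<in>UNIV. borel) (\<lambda>\<omega> k. Y k \<omega>)"
  proof (rule distr_eqI_covariance)
    show "X k \<in> span_B" "Y k \<in> span_B" for k
      unfolding X_def Y_def[abs_def] by (simp_all add: scale_G)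
    fix j k :: int
    let ?j = "\<bar>of_int j :: real\<bar>" and ?k = "\<bar>of_int k :: real\<bar>" and ?d = "\<bar>of_int j - of_int k :: real\<bar>"
    have "expectation (\<lambda>\<omega>. Y j \<omega> * Y k \<omega>)
      = expectation (\<lambda>\<omega>. (c * ?j powr (-\<alpha>) * (c * ?k powr (-\<alpha>))) * (B (\<delta> * of_int j) \<omega> * B (\<delta> * of_int k) \<omega>))"
      unfolding Y_def by (intro Bochner_Integration.integral_cong refl) (simp only: mult_ac)
    also have "\<dots> = (c * ?j powr (-\<alpha>) * (c * ?k powr (-\<alpha>))) * ((\<delta> powr \<alpha>) * ((?j powr \<alpha> + ?k powr \<alpha> - ?d powr \<alpha>) / 2))"
    proof -
      have "\<bar>\<delta> * of_int j - \<delta> * of_int k\<bar> powr \<alpha> = \<delta> powr \<alpha> * ?d powr \<alpha>"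
        using \<delta> by (simp add: abs_mult powr_mult flip: right_diff_distrib)
      moreover have "\<bar>\<delta> * of_int i\<bar> powr \<alpha> = \<delta> powr \<alpha> * \<bar>of_int i\<bar> powr \<alpha>" for i
        using \<delta> by (simp add: abs_mult powr_mult)
      moreover have "(x * u + x * v - x * w) / 2 = x * ((u + v - w) / 2)" for x u v w :: real
        by (simp add: algebra_simps)
      ultimately show ?thesis
        unfolding integral_mult_right_zero covariance_B by (simp only:)
    qed
    also have "\<dots> = (c * c * \<delta> powr \<alpha>) * (?j powr (-\<alpha>) * ?k powr (-\<alpha>) * ((?j powr \<alpha> + ?k powr \<alpha> - ?d powr \<alpha>) / 2))"
      by (simp only: mult_ac)
    also have "\<dots> = ?j powr (-\<alpha>) * ?k powr (-\<alpha>) * ((?j powr \<alpha> + ?k powr \<alpha> - ?d powr \<alpha>) / 2)"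
      unfolding c by simp
    also have "\<dots> = (\<bar>1 / of_int j\<bar> powr \<alpha> + \<bar>1 / of_int k\<bar> powr \<alpha> - \<bar>1 / of_int j - 1 / of_int k\<bar> powr \<alpha>) / 2"
    proof (cases "j = 0 \<or> k = 0")
      \<comment> \<open>Here \<open>1 / 0 = 0\<close> and \<open>0 powr (-\<alpha>) = 0\<close>, so
        both sides are 0.\<close>
      case True
      then show ?thesis by auto
    next
      case False
      have "\<bar>1 / of_int j - 1 / of_int k :: real\<bar> = ?d / (?j * ?k)"
        using False by (simp add: field_simps abs_minus_commute flip: abs_mult)
      then have d: "\<bar>1 / of_int j - 1 / of_int k\<bar> powr \<alpha> = ?d powr \<alpha> * (?j powr (-\<alpha>) * ?k powr (-\<alpha>))"
        by (simp add: powr_divide powr_mult powr_minus_divide)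
      have j: "?j powr (-\<alpha>) * ?j powr \<alpha> = 1" "?k powr (-\<alpha>) * ?k powr \<alpha> = 1"
        using False by (simp_all flip: powr_add)
      have i: "\<bar>1 / of_int j\<bar> powr \<alpha> = ?j powr (-\<alpha>)" "\<bar>1 / of_int k\<bar> powr \<alpha> = ?k powr (-\<alpha>)"
        by (simp_all add: powr_divide powr_minus_divide)
      have alg: "x * y * ((p + q - r) / 2) = (x + y - r * (x * y)) / 2" if "x * p = 1" "y * q = 1" for x y p q r :: real
      proof -
        have "x * y * ((p + q - r) / 2) = ((x * p) * y + (y * q) * x - r * (x * y)) / 2"
          by (simp add: algebra_simps)
        then show ?thesis unfolding that by (simp add: algebra_simps)
      qed
      show ?thesis unfolding d i by (rule alg[OF j])
    qed
    also have "\<dots> = expectation (\<lambda>\<omega>. X j \<omega> * X k \<omega>)"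
      unfolding X_def covariance_B ..
    finally show "expectation (\<lambda>\<omega>. X j \<omega> * X k \<omega>) = expectation (\<lambda>\<omega>. Y j \<omega> * Y k \<omega>)" ..
  qed
  let ?A = "{x \<in> space (\<Pi>\<^sub>M t\<in>UNIV. borel). \<forall>k::int. k \<noteq> 0 \<longrightarrow> x k \<le> \<eta>}"
  have A: "?A \<in> sets (\<Pi>\<^sub>M t\<in>UNIV. borel)" by measurable
  have pr: "measure (distr M (\<Pi>\<^sub>M t\<in>UNIV. borel) (\<lambda>\<omega> k. W k \<omega>)) ?A = prob {\<omega>\<in>space M. \<forall>k. k \<noteq> 0 \<longrightarrow> W k \<omega> \<le> \<eta>}"
    if [measurable]: "\<And>k. W k \<in> borel_measurable M" for W :: "int \<Rightarrow> 'a \<Rightarrow> real"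
  proof -
    have "(\<lambda>\<omega> k. W k \<omega>) \<in> measurable M (\<Pi>\<^sub>M t\<in>UNIV. borel)"
      by (rule measurable_PiM_single') auto
    then show ?thesis
      using A by (subst measure_distr) (auto intro!: arg_cong[where f=prob] simp: space_PiM)
  qed
  have "prob {\<omega>\<in>space M. \<forall>k. k \<noteq> 0 \<longrightarrow> X k \<omega> \<le> \<eta>} = prob {\<omega>\<in>space M. \<forall>k. k \<noteq> 0 \<longrightarrow> Y k \<omega> \<le> \<eta>}"
    using pr[of X] pr[of Y] XY by (simp add: X_def Y_def[abs_def])
  also have "{\<omega>\<in>space M. \<forall>k. k \<noteq> 0 \<longrightarrow> Y k \<omega> \<le> \<eta>} = {\<omega>\<in>space M. \<forall>k::int. k \<noteq> 0 \<longrightarrow> Z (\<delta> * of_int k) \<omega> \<le> 0}"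
  proof -
    have "Y k \<omega> \<le> \<eta> \<longleftrightarrow> Z (\<delta> * of_int k) \<omega> \<le> 0" if "k \<noteq> 0" for k \<omega>
    proof -
      define p where "p = \<bar>of_int k :: real\<bar> powr \<alpha>"
      have p: "p > 0" using that by (simp add: p_def)
      have "Y k \<omega> = B (\<delta> * of_int k) \<omega> / (sqrt 2 * \<eta> * p)"
        by (simp add: Y_def c_def p_def powr_minus divide_inverse mult_ac)
      then have "Y k \<omega> \<le> \<eta> \<longleftrightarrow> B (\<delta> * of_int k) \<omega> \<le> \<eta> * (sqrt 2 * \<eta> * p)"
        using p \<eta> by (simp add: pos_divide_le_eq)
      also have "\<dots> \<longleftrightarrow> sqrt 2 * B (\<delta> * of_int k) \<omega> \<le> sqrt 2 * (\<eta> * (sqrt 2 * \<eta> * p))"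
        by (rule mult_le_cancel_left_pos[symmetric]) simp
      also have "sqrt 2 * (\<eta> * (sqrt 2 * \<eta> * p)) = (sqrt 2 * sqrt 2) * \<eta>\<^sup>2 * p"
        by (simp only: power2_eq_square mult_ac)
      also have "\<dots> = \<bar>\<delta> * of_int k\<bar> powr \<alpha>"
        using \<delta> by (simp add: abs_mult powr_mult \<delta>\<alpha> p_def)
      finally show ?thesis by (simp add: Z_def)
    qed
    then show ?thesis by blast
  qed
  also have "prob \<dots> = prob (stay_forever \<delta>)" by (rule prob_stay_forever[OF \<delta>, symmetric])
  finally show ?thesis by (simp add: X_def)
qed

end

theorem proposition3p1:
  fixes M :: "'a measure" and \<alpha> :: real and B :: "real \<Rightarrow> 'a \<Rightarrow> real"
  assumes "0 < \<alpha>" and "\<alpha> \<le> 2"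
    and "standard_fbm M \<alpha> B"
  shows "((\<lambda>\<eta>::real. \<eta> powr (- 2 / \<alpha>) *
            measure M {\<omega> \<in> space M. \<forall>k::int. k \<noteq> 0 \<longrightarrow> B (1 / of_int k) \<omega> \<le> \<eta>})
          \<longlongrightarrow> 2 powr (1 / \<alpha>) * pickands_constant M \<alpha> B) (at_right 0)"
proof -
  interpret standard_fbm M \<alpha> B by fact
  define \<delta> where "\<delta> \<eta> = 2 powr (1 / \<alpha>) * \<eta> powr (2 / \<alpha>)" for \<eta> :: real
  have "((\<lambda>\<eta>. \<eta> powr (2 / \<alpha>)) \<longlongrightarrow> (0::real)) (at_right 0)"
    using assms(1) by (intro tendsto_zero_powrI[where b="2 / \<alpha>"] tendsto_ident_at tendsto_const)
      (auto simp: eventually_at_right_field intro!: exI[of _ 1])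
  then have "(\<delta> \<longlongrightarrow> 2 powr (1 / \<alpha>) * 0) (at_right 0)"
    unfolding \<delta>_def by (intro tendsto_intros)
  moreover have pos: "eventually (\<lambda>\<eta>. 0 < \<eta>) (at_right (0::real))"
    by (auto simp: eventually_at_right_field intro!: exI[of _ 1])
  then have "eventually (\<lambda>\<eta>. 0 < \<delta> \<eta>) (at_right 0)"
    by eventually_elim (simp add: \<delta>_def)
  ultimately have "filterlim \<delta> (at_right 0) (at_right 0)"
    by (simp add: filterlim_at eventually_mono less_imp_neq[symmetric] eventually_conj_iff)
  then have "((\<lambda>\<eta>. 2 powr (1 / \<alpha>) * (prob (stay_forever (\<delta> \<eta>)) / \<delta> \<eta>)) \<longlongrightarrow> 2 powr (1 / \<alpha>) * pickands_constant M \<alpha> B) (at_right 0)"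
    by (intro tendsto_intros filterlim_compose[OF prob_stay_forever_tendsto[OF assms(1)]])
  then show ?thesis
  proof (rule Lim_transform_eventually)
    \<comment> \<open>The factor \<open>2 powr (1 / \<alpha>)\<close> cancels against the one in
      \<open>\<delta> \<eta>\<close>, leaving \<open>\<eta> powr (- 2 / \<alpha>)\<close>.\<close>
    show "eventually (\<lambda>\<eta>. 2 powr (1 / \<alpha>) * (prob (stay_forever (\<delta> \<eta>)) / \<delta> \<eta>)
      = \<eta> powr (- 2 / \<alpha>) * prob {\<omega> \<in> space M. \<forall>k::int. k \<noteq> 0 \<longrightarrow> B (1 / of_int k) \<omega> \<le> \<eta>}) (at_right 0)"
      using pos
    proof eventually_elim
      case (elim \<eta>)
      show ?case
        unfolding prob_harmonic_le[OF assms(1) elim \<delta>_def] using elim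
        by (simp add: \<delta>_def powr_minus divide_inverse)
    qed
  qed
qed

end
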